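(* A non-zero subspace $\mathcal{M}$ of the real Hardy space $H^2_{\mathbb{R}}(\mathbb{D})$ is almost invariant under the backward shift operator $T_z^*$ with finite defect $n$ if and only if $\mathcal{M}$ is of the form described in one of the following two cases, where $\mathcal{F}$ is the defect space and $\{e_i\}_{i=1}^n$ is an orthonormal basis of $\mathcal{F}$: (i) There exists a function in $\mathcal{M}$ which does not vanish at $0$, and there exists a $T_z^*\oplus T_z^*$-invariant subspace $\mathcal{N}$ of $H^2_{\mathbb{R}}(\mathbb{D})\oplus H^2_{\mathbb{R}}(\mathbb{D},\mathbb{C}^n)$ such that $$\mathcal{M}=\Big\{f=gh+z\sum_{i=1}^n h_ie_i : (h,h_1,\dots,h_n)\in\mathcal{N}\Big\},$$ where $g$ is the function of unit norm in $\mathcal{M}$, orthogonal to $\mathcal{M}\cap zH^2_{\mathbb{R}}(\mathbb{D})$, satisfying $g(0)>0$; further, $\|f\|^2=\|h\|^2+\sum_{i=1}^n\|h_i\|^2$ for all $f\in\mathcal{M}$; and, in addition, $T_z^*g\in\mathcal{M}\oplus\mathcal{F}$. (ii) All functions in $\mathcal{M}$ vanish at $0$, and there exists a $T_z^*$-invariant subspace $\mathcal{N}$ of $H^2_{\mathbb{R}}(\mathbb{D},\mathbb{C}^n)$ such that $$\mathcal{M}=\Big\{f=z\sum_{i=1}^n h_ie_i : (h_1,\dots,h_n)\in\mathcal{N}\Big\};$$ further, $\|f\|^2=\sum_{i=1}^n\|h_i\|^2$ for all $f\in\mathcal{M}$.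
   Context: $\mathbb{D}$ is the open unit disc. $H^2(\mathbb{D},\mathbb{C}^m)$ is the Hardy space of power series $F(z)=\sum_{k\ge0}A_kz^k$ with $A_k\in\mathbb{C}^m$ and $\sum\|A_k\|^2<\infty$, with inner product $\langle\sum A_kz^k,\sum B_kz^k\rangle=\sum\langle A_k,B_k\rangle_{\mathbb{C}^m}$. The real Hardy space $H^2_{\mathbb{R}}(\mathbb{D},\mathbb{C}^m)$ is the set of $F\in H^2(\mathbb{D},\mathbb{C}^m)$ with all $A_k\in\mathbb{R}^m$; it is a real Hilbert space with the same inner product, its elements are identified with $m$-tuples of elements of $H^2_{\mathbb{R}}(\mathbb{D}):=H^2_{\mathbb{R}}(\mathbb{D},\mathbb{C})$. "Subspace" means closed subspace. The backward shift is $(T_z^*F)(z)=\frac{F(z)-F(0)}{z}$ on each $H^2_{\mathbb{R}}(\mathbb{D},\mathbb{C}^m)$, and $T_z^*\oplus T_z^*$ acts coordinatewise on the direct sum. A subspace $\mathcal{M}$ of $H^2_{\mathbb{R}}(\mathbb{D})$ is almost invariant under $T_z^*$ if there is a finite-dimensional subspace $\mathcal{F}$ of $H^2_{\mathbb{R}}(\mathbb{D})$, orthogonal to $\mathcal{M}$, such that $T_z^*\mathcal{M}\subset\mathcal{M}\oplus\mathcal{F}$. It is nearly $T_z^*$-invariant with finite defect if there is a finite-dimensional subspace $\mathcal{F}$ of $H^2_{\mathbb{R}}(\mathbb{D})$, orthogonal to $\mathcal{M}$, such that $T_z^*(\mathcal{M}\cap zH^2_{\mathbb{R}}(\mathbb{D}))\subset\mathcal{M}\oplus\mathcal{F}$.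 In each case an $\mathcal{F}$ of the smallest dimension satisfying the inclusion is called the defect space of $\mathcal{M}$, and its dimension the defect of $\mathcal{M}$. *)

theory Defs
  imports "HOL-Analysis.Analysis" "HOL-Library.Function_Algebras"
begin

section \<open>The real Hardy space of the disc\<close>

text \<open>
  Elements of the Hardy space are power series, so they are represented by formal power series.
  Lemma \<open>conv_radius_hardy\<close> shows that they converge on the open unit disc; the product of formal
  power series is then the pointwise product of the functions on the disc, and the coefficient at
  0 is the value at 0.
\<close>

definition hardy :: "complex fps set" where
  "hardy = {F. summable (\<lambda>k. (cmod (fps_nth F k))\<^sup>2)}"

definition hardy_inner :: "complex fps \<Rightarrow> complex fps \<Rightarrow> complex" where
  "hardy_inner F G = (\<Sum>k. fps_nth F k * cnj (fps_nth G k))"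

typedef real_hardy = "{F \<in> hardy. \<forall>k. fps_nth F k \<in> \<real>}"
  morphisms series Abs_real_hardy
  by (rule exI[of _ 0]) (simp add: hardy_def)

setup_lifting type_definition_real_hardy

lemma hardyI_bound:
  assumes "F \<in> hardy" "G \<in> hardy"
    and "\<And>k. cmod (fps_nth H k) \<le> c * cmod (fps_nth F k) + d * cmod (fps_nth G k)"
  shows "H \<in> hardy"
proof -
  have "(cmod (fps_nth H k))\<^sup>2 \<le> 2 * c\<^sup>2 * (cmod (fps_nth F k))\<^sup>2 + 2 * d\<^sup>2 * (cmod (fps_nth G k))\<^sup>2" for k
  proof -
    let ?a = "c * cmod (fps_nth F k)" and ?b = "d * cmod (fps_nth G k)"
    have "(cmod (fps_nth H k))\<^sup>2 \<le> (?a + ?b)\<^sup>2"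
      using assms(3)[of k] by (intro power_mono) auto
    also have "\<dots> \<le> 2 * ?a\<^sup>2 + 2 * ?b\<^sup>2"
      using zero_le_power2[of "?a - ?b"] by (simp add: power2_sum power2_diff)
    finally show ?thesis by (simp add: power_mult_distrib)
  qed
  then show ?thesis
    using assms(1,2) unfolding hardy_def
    by (auto intro!: summable_comparison_test[where
          g = "\<lambda>k. 2 * c\<^sup>2 * (cmod (fps_nth F k))\<^sup>2 + 2 * d\<^sup>2 * (cmod (fps_nth G k))\<^sup>2"]
        summable_add summable_mult)
qed

lemma conv_radius_hardy:
  assumes "F \<in> hardy"
  shows "fps_conv_radius F \<ge> 1"
  unfolding fps_conv_radius_def
proof (rule conv_radius_geI_ex')
  fix r :: real
  assume r: "0 < r" "ereal r < 1"
  have "(\<lambda>k. (cmod (fps_nth F k))\<^sup>2) \<longlonglongrightarrow> 0"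
    using assms unfolding hardy_def by (intro summable_LIMSEQ_zero) simp
  then have "\<forall>\<^sub>F k in sequentially. (cmod (fps_nth F k))\<^sup>2 < 1"
    by (rule order_tendstoD) simp
  then have "\<forall>\<^sub>F k in sequentially. norm (fps_nth F k * of_real r ^ k) \<le> r ^ k"
  proof eventually_elim
    case (elim k)
    then have "cmod (fps_nth F k) \<le> 1"
      by (simp add: power_less_one_iff[symmetric] power2_less_eq_zero_iff abs_square_less_1)
    then show ?case
      using r by (simp add: norm_mult norm_power mult_left_le_one_le)
  qed
  moreover have "summable (\<lambda>k. r ^ k)"
    using r by (intro summable_geometric) auto
  ultimately show "summable (\<lambda>k. fps_nth F k * of_real r ^ k)"
    by (rule summable_comparison_test_ev)
qed

instantiation real_hardy :: real_vector
begin

lift_definition zero_real_hardy :: real_hardy is 0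
  by (simp add: hardy_def)

lift_definition plus_real_hardy :: "real_hardy \<Rightarrow> real_hardy \<Rightarrow> real_hardy" is "(+)"
  by (auto simp: norm_triangle_ineq intro: hardyI_bound[where c = 1 and d = 1])

lift_definition minus_real_hardy :: "real_hardy \<Rightarrow> real_hardy \<Rightarrow> real_hardy" is "(-)"
  by (auto simp: norm_triangle_ineq4 intro: hardyI_bound[where c = 1 and d = 1])

lift_definition uminus_real_hardy :: "real_hardy \<Rightarrow> real_hardy" is uminus
  by (auto simp: hardy_def)

lift_definition scaleR_real_hardy :: "real \<Rightarrow> real_hardy \<Rightarrow> real_hardy"
  is "\<lambda>r F. fps_const (complex_of_real r) * F"
  by (auto simp: hardy_def norm_mult power_mult_distrib)

instance
  by standard (transfer; auto simp: fps_eq_iff algebra_simps)+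

end

lemma summable_hardy_inner:
  assumes "F \<in> hardy" "G \<in> hardy"
  shows "summable (\<lambda>k. fps_nth F k * cnj (fps_nth G k))"
proof (rule summable_comparison_test)
  have "cmod (fps_nth F k * cnj (fps_nth G k)) \<le> (cmod (fps_nth F k))\<^sup>2 + (cmod (fps_nth G k))\<^sup>2" for k
  proof -
    let ?a = "cmod (fps_nth F k)" and ?b = "cmod (fps_nth G k)"
    have "2 * (?a * ?b) \<le> ?a\<^sup>2 + ?b\<^sup>2"
      using zero_le_power2[of "?a - ?b"] by (simp add: power2_diff)
    moreover have "0 \<le> ?a * ?b" by simp
    ultimately show ?thesis by (simp only: norm_mult complex_mod_cnj)
  qed
  then show "\<exists>N. \<forall>k\<ge>N. norm (fps_nth F k * cnj (fps_nth G k))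
      \<le> (cmod (fps_nth F k))\<^sup>2 + (cmod (fps_nth G k))\<^sup>2"
    by auto
  show "summable (\<lambda>k. (cmod (fps_nth F k))\<^sup>2 + (cmod (fps_nth G k))\<^sup>2)"
    using assms by (auto simp: hardy_def intro: summable_add)
qed

lemma series_hardy: "series f \<in> hardy"
  using series[of f] by simp

lemma hardy_inner_self:
  assumes "F \<in> hardy"
  shows "hardy_inner F F = of_real (\<Sum>k. (cmod (fps_nth F k))\<^sup>2)"
proof -
  have "(\<lambda>k. (cmod (fps_nth F k))\<^sup>2) sums (\<Sum>k. (cmod (fps_nth F k))\<^sup>2)"
    using assms by (simp add: hardy_def summable_sums)
  from sums_of_real[OF this, where 'a = complex] show ?thesis
    unfolding hardy_inner_def complex_norm_square by (rule sums_unique[symmetric])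
qed

instantiation real_hardy :: real_inner
begin

text \<open>The complex inner product of two series with real coefficients is real.\<close>

definition inner_real_hardy :: "real_hardy \<Rightarrow> real_hardy \<Rightarrow> real" where
  "inner_real_hardy f g = Re (hardy_inner (series f) (series g))"

definition norm_real_hardy :: "real_hardy \<Rightarrow> real" where
  "norm_real_hardy f = sqrt (inner f f)"

definition sgn_real_hardy :: "real_hardy \<Rightarrow> real_hardy" where
  "sgn_real_hardy f = f /\<^sub>R norm f"

definition dist_real_hardy :: "real_hardy \<Rightarrow> real_hardy \<Rightarrow> real" where
  "dist_real_hardy f g = norm (f - g)"

definition uniformity_real_hardy :: "(real_hardy \<times> real_hardy) filter" where
  "uniformity_real_hardy = (INF e\<in>{0<..}. principal {(f, g). dist f g < e})"

definition open_real_hardy :: "real_hardy set \<Rightarrow> bool" where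
  "open_real_hardy U \<longleftrightarrow> (\<forall>f\<in>U. \<forall>\<^sub>F (f', g) in uniformity. f' = f \<longrightarrow> g \<in> U)"

instance
proof
  fix f g h :: real_hardy and r :: real
  note s = summable_hardy_inner[OF series_hardy series_hardy]
  note defs = inner_real_hardy_def hardy_inner_def
  show "inner f g = inner g f"
  proof -
    have "Re (fps_nth (series f) k * cnj (fps_nth (series g) k))
        = Re (fps_nth (series g) k * cnj (fps_nth (series f) k))" for k
      by (simp add: mult.commute)
    then show ?thesis by (simp only: defs Re_suminf[OF s])
  qed
  show "inner (f + g) h = inner f h + inner g h"
    by (simp add: defs plus_real_hardy.rep_eq distrib_right suminf_add[OF s s, symmetric])
  show "inner (r *\<^sub>R f) g = r * inner f g"
    by (simp add: defs scaleR_real_hardy.rep_eq mult.assoc suminf_mult[OF s])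
  have sq: "inner f f = (\<Sum>k. (cmod (fps_nth (series f) k))\<^sup>2)"
    by (simp add: inner_real_hardy_def hardy_inner_self[OF series_hardy])
  have sm: "summable (\<lambda>k. (cmod (fps_nth (series f) k))\<^sup>2)"
    using series_hardy[of f] by (simp add: hardy_def)
  show "0 \<le> inner f f"
    unfolding sq by (intro suminf_nonneg sm) auto
  have "inner f f = 0 \<longleftrightarrow> (\<forall>k. (cmod (fps_nth (series f) k))\<^sup>2 = 0)"
    unfolding sq by (intro suminf_eq_zero_iff sm) auto
  also have "\<dots> \<longleftrightarrow> series f = 0"
    by (simp add: fps_eq_iff)
  also have "\<dots> \<longleftrightarrow> f = 0"
    by (metis series_inject zero_real_hardy.rep_eq)
  finally show "inner f f = 0 \<longleftrightarrow> f = 0" .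
qed (simp_all add: norm_real_hardy_def sgn_real_hardy_def dist_real_hardy_def
      uniformity_real_hardy_def open_real_hardy_def)

end

text \<open>\<^term>\<open>fps_shift 1 F\<close> is \<open>(F - F(0)) / z\<close>.\<close>

lift_definition bshift :: "real_hardy \<Rightarrow> real_hardy" is "fps_shift 1"
  by (auto simp: hardy_def summable_Suc_iff[where f = "\<lambda>k. (cmod (fps_nth _ k))\<^sup>2"])

definition z_hardy :: "real_hardy set" where
  "z_hardy = {f. \<exists>h. series f = fps_X * series h}"


section \<open>Vector-valued real Hardy spaces\<close>

instantiation "fun" :: (type, real_vector) real_vector
begin

definition scaleR_fun :: "real \<Rightarrow> ('a \<Rightarrow> 'b) \<Rightarrow> 'a \<Rightarrow> 'b" where
  "scaleR_fun r f = (\<lambda>x. r *\<^sub>R f x)"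

instance
  by standard (auto simp: scaleR_fun_def fun_eq_iff algebra_simps)

end

text \<open>
  The space \<open>H\<^sup>2\<^sub>\<real>(\<D>, \<complex>\<^sup>n)\<close>, as the \<open>n\<close>-tuples \<open>(H 0, \<dots>, H (n - 1))\<close> of elements
  of the scalar space, padded with zeros. On this set the (product) topology of
  \<^typ>\<open>nat \<Rightarrow> real_hardy\<close> is the topology of the Hilbert space norm
  \<open>sqrt (\<Sum>i<n. (norm (H i))\<^sup>2)\<close>, so that \<^const>\<open>closed\<close> has the intended meaning for its subspaces,
  and for those of its product with \<^typ>\<open>real_hardy\<close>.
\<close>

definition vec_hardy :: "nat \<Rightarrow> (nat \<Rightarrow> real_hardy) set" where
  "vec_hardy n = {H. \<forall>i\<ge>n. H i = 0}"

definition vec_bshift :: "(nat \<Rightarrow> real_hardy) \<Rightarrow> nat \<Rightarrow> real_hardy" where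
  "vec_bshift H = (\<lambda>i. bshift (H i))"


section \<open>Almost invariant subspaces\<close>

definition orthogonal_sets :: "'a::real_inner set \<Rightarrow> 'a set \<Rightarrow> bool" where
  "orthogonal_sets M F \<longleftrightarrow> (\<forall>f\<in>M. \<forall>u\<in>F. orthogonal f u)"

definition sum_space :: "'a::real_vector set \<Rightarrow> 'a set \<Rightarrow> 'a set" where
  "sum_space M F = {f + u | f u. f \<in> M \<and> u \<in> F}"

definition finite_dim_subspace :: "'a::real_vector set \<Rightarrow> bool" where
  "finite_dim_subspace F \<longleftrightarrow> subspace F \<and> (\<exists>B. finite B \<and> F = span B)"

definition almost_invariant_wrt :: "real_hardy set \<Rightarrow> real_hardy set \<Rightarrow> bool" where
  "almost_invariant_wrt M F \<longleftrightarrow>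
     finite_dim_subspace F \<and> orthogonal_sets M F \<and> bshift ` M \<subseteq> sum_space M F"

definition almost_invariant :: "real_hardy set \<Rightarrow> bool" where
  "almost_invariant M \<longleftrightarrow> (\<exists>F. almost_invariant_wrt M F)"

definition defect_space :: "real_hardy set \<Rightarrow> real_hardy set \<Rightarrow> bool" where
  "defect_space M F \<longleftrightarrow>
     almost_invariant_wrt M F \<and> (\<forall>F'. almost_invariant_wrt M F' \<longrightarrow> dim F \<le> dim F')"

definition defect :: "real_hardy set \<Rightarrow> nat" where
  "defect M = (LEAST d. \<exists>F. almost_invariant_wrt M F \<and> dim F = d)"


section \<open>The two forms\<close>

definition orthonormal_basis :: "nat \<Rightarrow> (nat \<Rightarrow> 'a::real_inner) \<Rightarrow> 'a set \<Rightarrow> bool" where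
  "orthonormal_basis n e F \<longleftrightarrow>
     (\<forall>i<n. \<forall>j<n. inner (e i) (e j) = (if i = j then 1 else 0)) \<and> span (e ` {..<n}) = F"

text \<open>
  In the representations below the right-hand sides are power series that a priori need not lie in
  the Hardy space, so \<open>M\<close> is compared with them through its image under \<^const>\<open>series\<close>.
\<close>

definition rep_nonvanishing ::
    "nat \<Rightarrow> real_hardy \<Rightarrow> (nat \<Rightarrow> real_hardy) \<Rightarrow> real_hardy \<Rightarrow> (nat \<Rightarrow> real_hardy) \<Rightarrow> complex fps" where
  "rep_nonvanishing n g e h H =
     series g * series h + fps_X * (\<Sum>i<n. series (H i) * series (e i))"

definition rep_vanishing ::
    "nat \<Rightarrow> (nat \<Rightarrow> real_hardy) \<Rightarrow> (nat \<Rightarrow> real_hardy) \<Rightarrow> complex fps" where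
  "rep_vanishing n e H = fps_X * (\<Sum>i<n. series (H i) * series (e i))"

definition nonvanishing_form ::
    "nat \<Rightarrow> real_hardy set \<Rightarrow> real_hardy set \<Rightarrow> (nat \<Rightarrow> real_hardy) \<Rightarrow> bool" where
  "nonvanishing_form n M F e \<longleftrightarrow>
     (\<exists>f\<in>M. fps_nth (series f) 0 \<noteq> 0) \<and>
     (\<exists>g\<in>M. norm g = 1 \<and> orthogonal_sets {g} (M \<inter> z_hardy) \<and>
        Re (fps_nth (series g) 0) > 0 \<and>
        (\<exists>N \<subseteq> UNIV \<times> vec_hardy n.
           subspace N \<and> closed N \<and> (\<forall>(h, H)\<in>N. (bshift h, vec_bshift H) \<in> N) \<and>
           series ` M = {rep_nonvanishing n g e h H | h H. (h, H) \<in> N} \<and>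
           (\<forall>f\<in>M. \<forall>(h, H)\<in>N. series f = rep_nonvanishing n g e h H \<longrightarrow>
              (norm f)\<^sup>2 = (norm h)\<^sup>2 + (\<Sum>i<n. (norm (H i))\<^sup>2))) \<and>
        bshift g \<in> sum_space M F)"

definition vanishing_form ::
    "nat \<Rightarrow> real_hardy set \<Rightarrow> (nat \<Rightarrow> real_hardy) \<Rightarrow> bool" where
  "vanishing_form n M e \<longleftrightarrow>
     (\<forall>f\<in>M. fps_nth (series f) 0 = 0) \<and>
     (\<exists>N \<subseteq> vec_hardy n.
        subspace N \<and> closed N \<and> (\<forall>H\<in>N. vec_bshift H \<in> N) \<and>
        series ` M = {rep_vanishing n e H | H. H \<in> N} \<and>
        (\<forall>f\<in>M. \<forall>H\<in>N. series f = rep_vanishing n e H \<longrightarrow>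
           (norm f)\<^sup>2 = (\<Sum>i<n. (norm (H i))\<^sup>2)))"

text \<open>
  What the two forms presuppose about \<open>F\<close> and \<open>e\<close>. The last conjunct is the minimality part of
  ``\<open>F\<close> is the defect space''; without it the forms only give defect at most \<open>n\<close>, since \<open>N\<close> may have components that
  are identically zero. The inclusion \<open>T\<^sub>z\<^sup>* M \<subseteq> M \<oplus> F\<close> is deliberately not part of this
  condition: it is what the forms have to yield.
\<close>

definition admissible ::
    "nat \<Rightarrow> real_hardy set \<Rightarrow> real_hardy set \<Rightarrow> (nat \<Rightarrow> real_hardy) \<Rightarrow> bool" where
  "admissible n M F e \<longleftrightarrow>
     orthogonal_sets M F \<and> orthonormal_basis n e F \<and>
     (\<forall>F'. almost_invariant_wrt M F' \<longrightarrow> n \<le> dim F')"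

end

theory Submission
  imports Defs "HOL-Complex_Analysis.Great_Picard"
begin

text \<open>
  Write \<open>B\<close> for the backward shift and \<open>P\<close> for the orthogonal projection onto \<open>M\<close>. If \<open>B M\<close> lies in
  \<open>M \<oplus> F\<close> and \<open>f\<close> is in \<open>M\<close>, then subtracting from \<open>f\<close> its component along the extremal function \<open>g\<close>
  leaves a function \<open>f\<^sub>1\<close> of \<open>M\<close> vanishing at 0, and \<open>B f\<^sub>1 = R f + \<Sum> c\<^sub>i e\<^sub>i\<close> with \<open>R f = P B f\<^sub>1\<close>.
  Hence \<open>f = a g + z (\<Sum> c\<^sub>i e\<^sub>i) + z R f\<close> and \<open>\<parallel>f\<parallel>\<^sup>2 = a\<^sup>2 + \<Sum> c\<^sub>i\<^sup>2 + \<parallel>R f\<parallel>\<^sup>2\<close>. Iterating, the scalars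
  produced by \<open>f, R f, R\<^sup>2 f, \<dots>\<close> become the Taylor coefficients of \<open>h, h\<^sub>1, \<dots>, h\<^sub>n\<close>, and replacing \<open>f\<close>
  by \<open>R f\<close> applies \<open>B\<close> to all of them. Comparing coefficients gives \<open>f = g h + z \<Sum> h\<^sub>i e\<^sub>i\<close>. If all of
  \<open>M\<close> vanishes at 0 the same works without \<open>g\<close>. Both cases are instances of the locale
  \<open>wandering_expansion\<close>, where the generators \<open>g, z e\<^sub>1, \<dots>, z e\<^sub>n\<close> are called \<open>w\<^sub>j\<close> and the
  scalars are inner products with vectors \<open>\<delta>\<^sub>j\<close>.

  The difficulty is the norm identity, which is equivalent to \<open>R\<^sup>K f \<rightarrow> 0\<close> for all \<open>f\<close> in \<open>M\<close>
  (lemma \<open>remainder_stable\<close>); it also makes the set of coordinate tuples closed. The coordinates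
  themselves satisfy \<open>B\<^sup>K h\<^sub>j \<rightarrow> 0\<close>, but multiplication by \<open>w\<^sub>j\<close> is unbounded, so this
  does not settle the matter. The remedy is to smooth \<open>f\<close> by a function of \<open>R\<close>. Let \<open>\<Omega>\<close> be the analytic
  function whose real part on the circle is \<open>\<Sum> \<bar>w\<^sub>l\<bar>\<^sup>2\<close>. If \<open>y + \<Omega>(B) y = u\<close>, then formally
  \<open>\<langle>\<Omega>(B) y, y\<rangle> = \<Sum> \<parallel>w\<^sub>l y\<parallel>\<^sup>2\<close>, so \<open>\<parallel>y\<parallel>\<^sup>2 + \<Sum> \<parallel>w\<^sub>l y\<parallel>\<^sup>2 = \<langle>u, y\<rangle>\<close>: on such \<open>y\<close> multiplication by \<open>w\<^sub>l\<close>
  is bounded by \<open>\<parallel>u\<parallel>\<close>. To stay with bounded operators the \<open>w\<^sub>l\<close> are truncated to their first \<open>N\<close>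
  coefficients, which turns \<open>\<Omega>\<close> into a polynomial. Since \<open>R\<close> is a contraction, \<open>\<Omega>(R)\<close> has nonnegative
  real part, so \<open>v + \<Omega>(R) v = q\<close> has a solution \<open>v\<^sub>N\<close> in \<open>M\<close> with \<open>\<parallel>v\<^sub>N\<parallel> \<le> \<parallel>q\<parallel>\<close>, whose coordinates solve
  the same equation for \<open>B\<close>. A weak limit \<open>u\<close> of the \<open>v\<^sub>N\<close> then satisfies \<open>R\<^sup>K u \<rightarrow> 0\<close>. Taking \<open>q\<close>
  orthogonal to the closed subspace of all functions with this property,
  \<open>\<parallel>v\<^sub>N\<parallel>\<^sup>2 \<le> \<langle>q, v\<^sub>N\<rangle> \<rightarrow> \<langle>q, u\<rangle> = 0\<close> along a subsequence, and the energy identity forces every coefficient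
  of the coordinates of \<open>q\<close> to be 0. So \<open>q = 0\<close>, and the subspace is all of \<open>M\<close>.

  Conversely, peeling off the constant terms of \<open>h, h\<^sub>1, \<dots>, h\<^sub>n\<close> in the representation of \<open>f\<close> shows
  \<open>B f = h(0) B g + \<Sum> h\<^sub>i(0) e\<^sub>i + f'\<close>, where \<open>f'\<close> is represented by the shifted tuple and thus lies in \<open>M\<close>;
  so \<open>B M\<close> lies in \<open>M \<oplus> F\<close>.
\<close>

section \<open>The space as square-summable real sequences\<close>

definition coef :: "real_hardy \<Rightarrow> nat \<Rightarrow> real" where
  "coef f k = Re (fps_nth (series f) k)"

lemma fps_nth_series: "fps_nth (series f) k = of_real (coef f k)"
proof -
  have "fps_nth (series f) k \<in> \<real>"
    using series[of f] by simp
  then show ?thesis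
    by (simp add: coef_def complex_is_Real_iff complex_eq_iff)
qed

lemma real_hardy_eqI: "(\<And>k. coef f k = coef g k) \<Longrightarrow> f = g"
  by (metis fps_ext fps_nth_series series_inject)

lemma coef_zero [simp]: "coef 0 k = 0"
  and coef_add [simp]: "coef (f + g) k = coef f k + coef g k"
  and coef_diff [simp]: "coef (f - g) k = coef f k - coef g k"
  and coef_scaleR [simp]: "coef (r *\<^sub>R f) k = r * coef f k"
  and coef_bshift [simp]: "coef (bshift f) k = coef f (Suc k)"
  by (simp_all add: coef_def zero_real_hardy.rep_eq plus_real_hardy.rep_eq
      minus_real_hardy.rep_eq scaleR_real_hardy.rep_eq bshift.rep_eq)

lemma coef_sum [simp]: "coef (sum h A) k = (\<Sum>i\<in>A. coef (h i) k)"
  by (induction A rule: infinite_finite_induct) auto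

lemma series_sum: "series (sum h A) = (\<Sum>i\<in>A. series (h i))"
  by (induction A rule: infinite_finite_induct)
    (auto simp: zero_real_hardy.rep_eq plus_real_hardy.rep_eq)

lemma inner_sums: "(\<lambda>k. coef f k * coef g k) sums inner f g"
proof -
  have "(\<lambda>k. fps_nth (series f) k * cnj (fps_nth (series g) k))
      sums hardy_inner (series f) (series g)"
    unfolding hardy_inner_def
    by (intro summable_sums summable_hardy_inner series_hardy)
  from sums_Re[OF this] show ?thesis
    by (simp add: inner_real_hardy_def fps_nth_series)
qed

lemma norm_sums: "(\<lambda>k. (coef f k)\<^sup>2) sums (norm f)\<^sup>2"
  using inner_sums[of f f] by (simp only: power2_norm_eq_inner power2_eq_square[of "coef f _"])

lemma ex_coef_eq:
  assumes "summable (\<lambda>k. (a k)\<^sup>2)"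
  shows "\<exists>f. \<forall>k. coef f k = a k"
proof -
  have "Abs_fps (\<lambda>k. complex_of_real (a k)) \<in> {F \<in> hardy. \<forall>k. fps_nth F k \<in> \<real>}"
    using assms by (simp add: hardy_def)
  then show ?thesis
    by (intro exI[of _ "Abs_real_hardy (Abs_fps (\<lambda>k. complex_of_real (a k)))"])
      (simp add: coef_def Abs_real_hardy_inverse)
qed

lift_definition fshift :: "real_hardy \<Rightarrow> real_hardy" is "\<lambda>F. fps_X * F"
proof -
  fix F :: "complex fps" assume F: "F \<in> hardy \<and> (\<forall>k. fps_nth F k \<in> \<real>)"
  have "summable (\<lambda>k. (cmod (fps_nth (fps_X * F) (Suc k)))\<^sup>2)"
    using F by (simp add: hardy_def)
  then have "fps_X * F \<in> hardy"
    unfolding hardy_def mem_Collect_eq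
    by (subst summable_Suc_iff[symmetric, where f = "\<lambda>k. (cmod (fps_nth (fps_X * F) k))\<^sup>2"])
  then show "fps_X * F \<in> hardy \<and> (\<forall>k. fps_nth (fps_X * F) k \<in> \<real>)"
    using F by simp
qed

lemma coef_fshift: "coef (fshift f) k = (case k of 0 \<Rightarrow> 0 | Suc j \<Rightarrow> coef f j)"
  by (cases k) (simp_all add: coef_def fshift.rep_eq)

lemma coef_fshift_simps [simp]: "coef (fshift f) 0 = 0" "coef (fshift f) (Suc k) = coef f k"
  by (simp_all add: coef_fshift)

definition one_hardy :: real_hardy where
  "one_hardy = (SOME f. \<forall>k. coef f k = (if k = 0 then 1 else 0))"

lemma coef_one: "coef one_hardy k = (if k = 0 then 1 else 0)"
proof -
  have "\<exists>f. \<forall>k. coef f k = (if k = 0 then 1 else 0)"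
    by (rule ex_coef_eq, rule summable_finite[of "{0}"]) auto
  from someI_ex[OF this] show ?thesis
    unfolding one_hardy_def by blast
qed

lemma inner_one: "inner f one_hardy = coef f 0"
proof -
  have "(\<lambda>k. coef f k * coef one_hardy k) sums (\<Sum>k\<in>{0}. coef f k * coef one_hardy k)"
    by (rule sums_finite) (auto simp: coef_one)
  from sums_unique2[OF inner_sums this] show ?thesis by (simp add: coef_one)
qed

lemma linear_bshift: "linear bshift" and linear_fshift: "linear fshift"
  by (auto intro!: linearI real_hardy_eqI simp: coef_fshift split: nat.split)

lemma bshift_fshift [simp]: "bshift (fshift f) = f"
  by (rule real_hardy_eqI) simp

lemma fshift_bshift: "fshift (bshift f) = f - coef f 0 *\<^sub>R one_hardy"
  by (rule real_hardy_eqI) (auto simp: coef_fshift coef_one split: nat.split)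

lemma inner_fshift: "inner (fshift f) g = inner f (bshift g)"
proof -
  have "(\<lambda>k. coef (fshift f) (Suc k) * coef g (Suc k)) sums inner f (bshift g)"
    using inner_sums[of f "bshift g"] by simp
  from sums_Suc[of "\<lambda>k. coef (fshift f) k * coef g k", OF this]
  have "(\<lambda>k. coef (fshift f) k * coef g k) sums inner f (bshift g)"
    by simp
  from sums_unique2[OF inner_sums this] show ?thesis .
qed

lemma inner_fshift_right: "inner f (fshift g) = inner (bshift f) g"
  by (metis inner_commute inner_fshift)

lemma z_hardy_iff: "f \<in> z_hardy \<longleftrightarrow> coef f 0 = 0"
proof
  assume "f \<in> z_hardy"
  then show "coef f 0 = 0" by (auto simp: z_hardy_def coef_def)
next
  assume "coef f 0 = 0"
  then have "f = fshift (bshift f)" by (simp add: fshift_bshift)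
  then show "f \<in> z_hardy" unfolding z_hardy_def by (metis (mono_tags) fshift.rep_eq mem_Collect_eq)
qed

lemma norm_bshift_sq: "(norm f)\<^sup>2 = (coef f 0)\<^sup>2 + (norm (bshift f))\<^sup>2"
proof -
  have "(\<lambda>k. (coef f k)\<^sup>2) sums ((norm (bshift f))\<^sup>2 + (coef f 0)\<^sup>2)"
    using norm_sums[of "bshift f"] by (intro sums_Suc) simp
  from sums_unique2[OF norm_sums this] show ?thesis by simp
qed

lemma norm_bshift_le: "norm (bshift f) \<le> norm f"
  by (rule power2_le_imp_le) (simp_all add: norm_bshift_sq[of f])

lemma coef_bshift_funpow [simp]: "coef ((bshift ^^ K) f) k = coef f (K + k)"
  by (induction K arbitrary: k) auto

lemma coef_fshift_funpow: "coef ((fshift ^^ i) f) k = (if i \<le> k then coef f (k - i) else 0)"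
  by (induction i arbitrary: k) (auto simp: coef_fshift split: nat.split)

lemma coef_eq_inner: "coef f k = inner f ((fshift ^^ k) one_hardy)"
proof (induction k arbitrary: f)
  case (Suc k)
  have "inner f ((fshift ^^ Suc k) one_hardy) = inner (bshift f) ((fshift ^^ k) one_hardy)"
    by (simp add: inner_fshift_right)
  then show ?case using Suc[of "bshift f"] by simp
qed (simp add: inner_one)

lemma coef_le_norm: "\<bar>coef f k\<bar> \<le> norm f"
proof -
  have "(coef f k)\<^sup>2 = (\<Sum>i\<in>{k}. (coef f i)\<^sup>2)" by simp
  also have "\<dots> \<le> (norm f)\<^sup>2"
    using norm_sums[of f] unfolding sums_unique[OF norm_sums[of f]]
    by (intro sum_le_suminf) (auto simp: sums_iff)
  finally have "(coef f k)\<^sup>2 \<le> (norm f)\<^sup>2" .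
  then show ?thesis by (metis abs_le_square_iff abs_norm_cancel)
qed

lemma norm_bshift_funpow_tendsto_0: "(\<lambda>K. norm ((bshift ^^ K) f)) \<longlonglongrightarrow> 0"
proof -
  have sm: "summable (\<lambda>k. (coef f k)\<^sup>2)"
    using norm_sums by (auto simp: sums_iff)
  have "(\<lambda>K. \<Sum>k. (coef f (k + K))\<^sup>2) \<longlonglongrightarrow> 0"
    using suminf_exist_split2[OF sm] .
  moreover have "(\<Sum>k. (coef f (k + K))\<^sup>2) = (norm ((bshift ^^ K) f))\<^sup>2" for K
    using sums_unique[OF norm_sums[of "(bshift ^^ K) f"]] by (simp add: add.commute)
  ultimately have "(\<lambda>K. (norm ((bshift ^^ K) f))\<^sup>2) \<longlonglongrightarrow> 0" by simp
  from tendsto_real_sqrt[OF this] show ?thesis by simp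
qed

text \<open>
  Fatou's lemma for square-summable sequences. It yields completeness of the space and weak limits
  of bounded sequences, and it bounds norms of products that are known only coefficient by
  coefficient.
\<close>

lemma coef_limit_Fatou:
  assumes bound: "\<And>N. norm (v N) \<le> C N" and C: "C \<longlonglongrightarrow> c"
    and lim: "\<And>k. (\<lambda>N. coef (v N) k) \<longlonglongrightarrow> a k"
  shows "\<exists>f. (\<forall>k. coef f k = a k) \<and> norm f \<le> c"
proof -
  have C0: "0 \<le> C N" for N
    using bound[of N] norm_ge_zero order_trans by blast
  then have c0: "0 \<le> c"
    using C by (intro LIMSEQ_le_const[OF C]) auto
  have part: "(\<Sum>k<n. (a k)\<^sup>2) \<le> c\<^sup>2" for n
  proof (rule LIMSEQ_le)
    show "(\<lambda>N. \<Sum>k<n. (coef (v N) k)\<^sup>2) \<longlonglongrightarrow> (\<Sum>k<n. (a k)\<^sup>2)"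
      by (intro tendsto_sum tendsto_power lim)
    show "(\<lambda>N. (C N)\<^sup>2) \<longlonglongrightarrow> c\<^sup>2"
      by (intro tendsto_power C)
    have "(\<Sum>k<n. (coef (v N) k)\<^sup>2) \<le> (C N)\<^sup>2" for N
    proof -
      have "(\<Sum>k<n. (coef (v N) k)\<^sup>2) \<le> (norm (v N))\<^sup>2"
        unfolding sums_unique[OF norm_sums[of "v N"]]
        using norm_sums[of "v N"] by (intro sum_le_suminf) (auto simp: sums_iff)
      also have "\<dots> \<le> (C N)\<^sup>2"
        by (intro power_mono bound) auto
      finally show ?thesis .
    qed
    then show "\<exists>N. \<forall>m\<ge>N. (\<Sum>k<n. (coef (v m) k)\<^sup>2) \<le> (C m)\<^sup>2" by blast
  qed
  have sm: "summable (\<lambda>k. (a k)\<^sup>2)"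
    by (rule summableI_nonneg_bounded[OF _ part]) auto
  then obtain f where f: "\<And>k. coef f k = a k" using ex_coef_eq by blast
  have "(norm f)\<^sup>2 = (\<Sum>k. (a k)\<^sup>2)"
    using sums_unique[OF norm_sums[of f]] by (simp add: f)
  also have "\<dots> \<le> c\<^sup>2"
    by (rule suminf_le_const[OF sm part])
  finally show ?thesis using f c0 power2_le_imp_le by blast
qed

instance real_hardy :: complete_space
proof
  fix X :: "nat \<Rightarrow> real_hardy" assume X: "Cauchy X"
  have "Cauchy (\<lambda>N. coef (X N) k)" for k
    unfolding coef_eq_inner
    by (rule bounded_linear.Cauchy[OF bounded_linear_inner_left X])
  then have lim: "\<exists>a. (\<lambda>N. coef (X N) k) \<longlonglongrightarrow> a" for k
    using Cauchy_convergent_iff convergent_def by blast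
  then obtain a where a: "\<And>k. (\<lambda>N. coef (X N) k) \<longlonglongrightarrow> a k" by metis
  obtain C where "\<And>N. norm (X N) \<le> C"
    using Cauchy_Bseq[OF X] by (auto simp: Bseq_def)
  then obtain f where f: "\<And>k. coef f k = a k"
    using coef_limit_Fatou[of X "\<lambda>_. C", OF _ tendsto_const a] by blast
  have "X \<longlonglongrightarrow> f"
  proof (rule LIMSEQ_I)
    fix r :: real assume "0 < r"
    then obtain N where N: "\<And>m n. m \<ge> N \<Longrightarrow> n \<ge> N \<Longrightarrow> norm (X m - X n) < r / 2"
      using CauchyD[OF X, of "r / 2"] by auto
    have "norm (X m - f) < r" if m: "m \<ge> N" for m
    proof -
      have "(\<lambda>n. coef (X m - X (n + N)) k) \<longlonglongrightarrow> coef (X m - f) k" for k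
        using LIMSEQ_ignore_initial_segment[OF a[of k], of N]
        by (auto simp: f intro!: tendsto_diff)
      then obtain h where h: "\<And>k. coef h k = coef (X m - f) k" "norm h \<le> r / 2"
        using coef_limit_Fatou[of "\<lambda>n. X m - X (n + N)" "\<lambda>_. r / 2", OF _ tendsto_const]
          N[OF m] by (metis le_add2 less_imp_le)
      then have "h = X m - f" by (intro real_hardy_eqI)
      then show ?thesis using h(2) \<open>0 < r\<close> by simp
    qed
    then show "\<exists>N. \<forall>n\<ge>N. norm (X n - f) < r" by blast
  qed
  then show "convergent X" by (rule convergentI)
qed

text \<open>
  On bounded sets coefficientwise convergence is weak convergence: the tail of the fixed vector
  \<open>x\<close> is small, and only finitely many coefficients remain.
\<close>

lemma coef_limit_inner:
  assumes bound: "\<And>N. norm (v N) \<le> C"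
    and lim: "\<And>k. (\<lambda>N. coef (v N) k) \<longlonglongrightarrow> coef w k"
  shows "(\<lambda>N. inner (v N) x) \<longlonglongrightarrow> inner w x"
proof -
  have C0: "0 \<le> C" using bound[of 0] norm_ge_zero order_trans by blast
  have wC: "norm w \<le> C"
    using coef_limit_Fatou[OF bound tendsto_const lim] real_hardy_eqI by blast
  have tail: "inner u x = (\<Sum>k<K. coef u k * coef x k) + inner ((bshift ^^ K) u) ((bshift ^^ K) x)"
    for u K
    using sums_unique[OF inner_sums[of u x]]
      sums_unique[OF inner_sums[of "(bshift ^^ K) u" "(bshift ^^ K) x"]]
      suminf_split_initial_segment[OF sums_summable[OF inner_sums[of u x]], of K]
    by (simp add: add.commute)
  have nb: "norm ((bshift ^^ K) u) \<le> norm u" for K u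
    by (induction K) (auto intro: order_trans[OF norm_bshift_le])
  show ?thesis
  proof (rule LIMSEQ_I)
    fix r :: real assume r: "0 < r"
    have "(\<lambda>K. 2 * C * norm ((bshift ^^ K) x)) \<longlonglongrightarrow> 2 * C * 0"
      by (intro tendsto_mult tendsto_const norm_bshift_funpow_tendsto_0)
    then have "\<forall>\<^sub>F K in sequentially. 2 * C * norm ((bshift ^^ K) x) < r / 2"
      using r by (intro order_tendstoD(2)) auto
    then obtain K where K: "2 * C * norm ((bshift ^^ K) x) < r / 2"
      by (auto simp: eventually_sequentially)
    have "(\<lambda>N. \<Sum>k<K. coef (v N) k * coef x k) \<longlonglongrightarrow> (\<Sum>k<K. coef w k * coef x k)"
      by (intro tendsto_sum tendsto_mult lim tendsto_const)
    from LIMSEQ_D[OF this half_gt_zero[OF r]]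
    obtain N0 where N0: "\<And>N. N \<ge> N0 \<Longrightarrow>
        \<bar>(\<Sum>k<K. coef (v N) k * coef x k) - (\<Sum>k<K. coef w k * coef x k)\<bar> < r / 2"
      unfolding real_norm_def by blast
    have "norm (inner (v N) x - inner w x) < r" if "N \<ge> N0" for N
    proof -
      have b: "\<bar>inner ((bshift ^^ K) u) ((bshift ^^ K) x)\<bar> \<le> C * norm ((bshift ^^ K) x)"
        if "norm u \<le> C" for u
        by (intro order_trans[OF Cauchy_Schwarz_ineq2] mult_right_mono
            order_trans[OF nb that]) auto
      show ?thesis
      proof -
        have tri: "\<bar>(a + c) - (b + d)\<bar> < r"
          if "\<bar>a - b\<bar> < r / 2" "\<bar>c\<bar> \<le> e" "\<bar>d\<bar> \<le> e" "2 * e < r / 2" for a b c d e :: real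
          using that by linarith
        have "2 * (C * norm ((bshift ^^ K) x)) < r / 2"
          using K by (simp only: mult.assoc)
        from tri[OF N0[OF that] b[OF bound[of N]] b[OF wC] this]
        show ?thesis
          by (simp only: tail[of "v N" K] tail[of w K] real_norm_def)
      qed
    qed
    then show "\<exists>N0. \<forall>N\<ge>N0. norm (inner (v N) x - inner w x) < r" by blast
  qed
qed

lemma bounded_imp_weak_subseq:
  fixes v :: "nat \<Rightarrow> real_hardy"
  assumes bound: "\<And>N. norm (v N) \<le> C"
  shows "\<exists>r w. strict_mono (r :: nat \<Rightarrow> nat) \<and> (\<forall>x. (\<lambda>N. inner (v (r N)) x) \<longlonglongrightarrow> inner w x)"
proof -
  have "norm (coef (v N) k) \<le> C" for N k
    unfolding real_norm_def by (rule order_trans[OF coef_le_norm bound])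
  then obtain r a where r: "strict_mono r" and a: "\<And>k. (\<lambda>N. coef (v (r N)) k) \<longlonglongrightarrow> a k"
  proof -
    obtain r where r: "strict_mono r" "\<And>k. \<exists>l. (\<lambda>N. coef (v (r N)) k) \<longlonglongrightarrow> l"
      by (rule function_convergent_subsequence[of UNIV "\<lambda>N k. coef (v N) k" C])
        (use \<open>\<And>N k. norm (coef (v N) k) \<le> C\<close> in auto)
    have "\<forall>k. \<exists>l. (\<lambda>N. coef (v (r N)) k) \<longlonglongrightarrow> l"
      using r(2) by blast
    from choice[OF this] that[OF r(1)] show ?thesis by blast
  qed
  obtain w where "\<And>k. coef w k = a k"
    using coef_limit_Fatou[of "\<lambda>N. v (r N)", OF bound tendsto_const a] by blast
  then show ?thesis
    using coef_limit_inner[of "\<lambda>N. v (r N)" C w] bound a r by auto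
qed

section \<open>Closed subspaces\<close>

text \<open>
  A minimizing sequence for the distance is Cauchy by the parallelogram law.
\<close>

lemma orthogonal_projection_exists:
  fixes S :: "'a :: {real_inner, complete_space} set"
  assumes S: "subspace S" "closed S"
  shows "\<exists>p\<in>S. \<forall>s\<in>S. inner (x - p) s = 0"
proof -
  define d where "d = (INF s\<in>S. (norm (x - s))\<^sup>2)"
  have bdd: "bdd_below ((\<lambda>s. (norm (x - s))\<^sup>2) ` S)"
    by (intro bdd_belowI[of _ 0]) auto
  have ne: "S \<noteq> {}" using subspace_0[OF S(1)] by auto
  have dle: "d \<le> (norm (x - s))\<^sup>2" if "s \<in> S" for s
    unfolding d_def by (rule cINF_lower[OF bdd that])
  define eps where "eps N = 1 / real (Suc N)" for N
  have eps_lim: "eps \<longlonglongrightarrow> 0"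
    unfolding eps_def by (rule LIMSEQ_Suc[OF lim_1_over_n])
  have eps_mono: "eps m \<le> eps N" if "N \<le> m" for m N
    unfolding eps_def using that by (auto intro!: divide_left_mono)
  have eps_pos: "0 < eps N" for N by (simp add: eps_def)
  have "\<exists>s\<in>S. (norm (x - s))\<^sup>2 < d + eps N" for N
    using cINF_less_iff[OF ne bdd, of "d + eps N"] eps_pos[of N] by (simp add: d_def)
  then obtain s where s: "\<And>N. s N \<in> S" "\<And>N. (norm (x - s N))\<^sup>2 < d + eps N"
    by metis
  have close: "(norm (s m - s k))\<^sup>2 \<le> 2 * (eps m + eps k)" for m k
  proof -
    let ?mid = "(1/2) *\<^sub>R (s m + s k)"
    have mid: "?mid \<in> S" by (intro subspace_scale subspace_add S s)
    have "(norm (s m - s k))\<^sup>2 + 4 * (norm (x - ?mid))\<^sup>2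
        = 2 * (norm (x - s m))\<^sup>2 + 2 * (norm (x - s k))\<^sup>2"
      by (simp add: power2_norm_eq_inner algebra_simps inner_commute)
    moreover have "(norm (x - s m))\<^sup>2 + (norm (x - s k))\<^sup>2
        \<le> 2 * d + (eps m + eps k)"
      using add_mono[OF less_imp_le[OF s(2)[of m]] less_imp_le[OF s(2)[of k]]]
      by (simp only: mult_2 add_ac)
    moreover have "A \<le> 2 * e" if "A + 4 * B = 2 * P + 2 * Q" "P + Q \<le> 2 * d + e" "d \<le> B"
      for A B P Q e :: real
      using that by linarith
    ultimately show ?thesis using dle[OF mid] by blast
  qed
  have "Cauchy s"
  proof (rule CauchyI)
    fix e :: real assume e: "0 < e"
    then obtain N where N: "eps N < e\<^sup>2 / 4"
      using order_tendstoD(2)[OF eps_lim, of "e\<^sup>2 / 4"] by (auto simp: eventually_sequentially)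
    have "norm (s m - s k) < e" if "m \<ge> N" "k \<ge> N" for m k
    proof -
      have "eps m \<le> eps N" "eps k \<le> eps N"
        using that by (auto intro: eps_mono)
      then have "2 * (eps m + eps k) < e\<^sup>2"
        using N unfolding distrib_left by linarith
      with close[of m k] have "(norm (s m - s k))\<^sup>2 < e\<^sup>2"
        by (rule le_less_trans)
      then show ?thesis by (rule power2_less_imp_less) (use e in simp)
    qed
    then show "\<exists>M. \<forall>m\<ge>M. \<forall>n\<ge>M. norm (s m - s n) < e" by blast
  qed
  then obtain p where p: "s \<longlonglongrightarrow> p" using Cauchy_convergent convergent_def by blast
  have pS: "p \<in> S" using closed_sequentially[OF S(2)] s(1) p by blast
  have "(\<lambda>N. d + eps N) \<longlonglongrightarrow> d + 0"
    by (intro tendsto_add tendsto_const) (rule eps_lim)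
  moreover have "(\<lambda>N. (norm (x - s N))\<^sup>2) \<longlonglongrightarrow> (norm (x - p))\<^sup>2"
    by (intro tendsto_intros p)
  ultimately have pd: "(norm (x - p))\<^sup>2 \<le> d"
    using LIMSEQ_le[of "\<lambda>N. (norm (x - s N))\<^sup>2" "(norm (x - p))\<^sup>2" "\<lambda>N. d + eps N" "d + 0"]
      less_imp_le[OF s(2)] by simp
  have "inner (x - p) u = 0" if u: "u \<in> S" for u
  proof (cases "u = 0")
    case False
    \<comment> \<open>the minimizer of the distance from \<open>x\<close> to the line through \<open>p\<close> in direction \<open>u\<close>\<close>
    define c where "c = inner (x - p) u / inner u u"
    have uu: "inner u u \<noteq> 0" using False by simp
    have "p + c *\<^sub>R u \<in> S" by (intro subspace_add subspace_scale S pS u)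
    from dle[OF this] pd have "(norm (x - p))\<^sup>2 \<le> (norm (x - (p + c *\<^sub>R u)))\<^sup>2" by linarith
    also have "\<dots> = (norm (x - p))\<^sup>2 - 2 * c * inner (x - p) u + c * c * inner u u"
      unfolding power2_norm_eq_inner
      by (simp add: algebra_simps inner_commute)
    also have "\<dots> = (norm (x - p))\<^sup>2 - (inner (x - p) u)\<^sup>2 / inner u u"
      using uu by (simp add: c_def field_simps power2_eq_square)
    finally have "(inner (x - p) u)\<^sup>2 / inner u u \<le> 0" by linarith
    moreover have "0 < inner u u" using False by simp
    ultimately show ?thesis by (simp add: divide_le_0_iff)
  qed simp
  then show ?thesis using pS by blast
qed

lemma weak_limit_in_closed_subspace:
  fixes S :: "'a :: {real_inner, complete_space} set"
  assumes S: "subspace S" "closed S" and v: "\<And>N. v N \<in> S"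
    and lim: "\<And>x. (\<lambda>N::nat. inner (v N) x) \<longlonglongrightarrow> inner w x"
  shows "w \<in> S"
proof -
  obtain p where p: "p \<in> S" "\<And>s. s \<in> S \<Longrightarrow> inner (w - p) s = 0"
    using orthogonal_projection_exists[OF S, of w] by blast
  have "(\<lambda>N. inner (v N) (w - p)) \<longlonglongrightarrow> 0"
    using p(2)[OF v] by (simp add: inner_commute)
  then have "inner w (w - p) = 0" using lim LIMSEQ_unique by blast
  then have "inner (w - p) (w - p) = 0"
    using p by (simp add: inner_diff_left inner_commute)
  then show ?thesis using p(1) by simp
qed

text \<open>
  The Lax-Milgram argument: for \<open>s = 1 / D\<^sup>2\<close>, where \<open>D\<close> bounds the norm of
  \<open>L\<close>, the map \<open>v \<mapsto> v - s (L v - f)\<close> is a contraction with constant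
  \<open>sqrt (1 - s)\<close>.
\<close>

lemma coercive_equation_solvable:
  fixes S :: "'a :: {real_inner, complete_space} set"
  assumes S: "subspace S" "closed S" and L: "linear L" "L ` S \<subseteq> S"
    and bound: "\<And>v. v \<in> S \<Longrightarrow> norm (L v) \<le> C * norm v"
    and coercive: "\<And>v. v \<in> S \<Longrightarrow> (norm v)\<^sup>2 \<le> inner (L v) v"
    and f: "f \<in> S"
  shows "\<exists>v\<in>S. L v = f"
proof -
  \<comment> \<open>the bound must be positive for the step size to make sense\<close>
  define D where "D = max 1 C"
  have D: "1 \<le> D" "\<And>v. v \<in> S \<Longrightarrow> norm (L v) \<le> D * norm v"
    unfolding D_def using bound
    by (auto intro!: order_trans[OF bound mult_right_mono])
  define s where "s = 1 / D\<^sup>2"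
  have D2: "1 \<le> D\<^sup>2" using D(1) by simp
  have s: "0 < s" "s \<le> 1" using D2 by (auto simp: s_def divide_le_eq_1)
  define T where "T v = v - s *\<^sub>R (L v - f)" for v
  define c where "c = sqrt (1 - s)"
  have c: "0 \<le> c" "c < 1" using s by (auto simp: c_def)
  have "\<exists>!v. v \<in> S \<and> T v = v"
  proof (rule Banach_fix)
    show "complete S" using S(2) by (simp add: complete_eq_closed)
    show "S \<noteq> {}" using f by auto
    show "T ` S \<subseteq> S"
      using L(2) by (auto simp: T_def intro!: subspace_diff subspace_scale S f)
    fix x y assume xy: "x \<in> S" "y \<in> S"
    let ?z = "x - y"
    have z: "?z \<in> S" using subspace_diff[OF S(1) xy] .
    have expand: "(norm (z - s *\<^sub>R l))\<^sup>2 = (norm z)\<^sup>2 - 2 * s * inner l z + s\<^sup>2 * (norm l)\<^sup>2" for z l :: 'a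
      unfolding power2_norm_eq_inner
      by (simp add: inner_diff_left inner_diff_right inner_commute power2_eq_square algebra_simps)
    have "dist (T x) (T y) = norm (?z - s *\<^sub>R L ?z)"
      by (simp add: T_def dist_norm linear_diff[OF L(1)] algebra_simps)
    then have "(dist (T x) (T y))\<^sup>2 = (norm ?z)\<^sup>2 - 2 * s * inner (L ?z) ?z + s\<^sup>2 * (norm (L ?z))\<^sup>2"
      by (simp only: expand)
    also have "\<dots> \<le> (norm ?z)\<^sup>2 - 2 * s * (norm ?z)\<^sup>2 + s\<^sup>2 * (D * norm ?z)\<^sup>2"
      using coercive[OF z] D(2)[OF z] s
      by (intro add_mono diff_mono mult_left_mono power_mono) auto
    also have "\<dots> = (1 - s) * (norm ?z)\<^sup>2"
      using D2 by (simp add: s_def power_mult_distrib field_simps power2_eq_square)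
    also have "\<dots> = (c * dist x y)\<^sup>2"
      using s by (simp add: c_def power_mult_distrib dist_norm)
    finally show "dist (T x) (T y) \<le> c * dist x y"
      by (rule power2_le_imp_le) (use c in simp)
  qed (use c in auto)
  then obtain v where "v \<in> S" "T v = v" by blast
  then show ?thesis using s by (auto simp: T_def)
qed

section \<open>Truncated products and Toeplitz forms\<close>

text \<open>
  Multiplication by the Taylor polynomial of degree less than \<open>N\<close> of \<open>x\<close>, which is
  bounded even when multiplication by \<open>x\<close> is not.
\<close>

definition trunc_mult :: "real_hardy \<Rightarrow> nat \<Rightarrow> real_hardy \<Rightarrow> real_hardy" where
  "trunc_mult x N y = (\<Sum>i<N. coef x i *\<^sub>R (fshift ^^ i) y)"

text \<open>
  Let \<open>p = \<Sum>i<N. a i z\<^sup>i\<close>. The trigonometric polynomial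
  \<open>\<bar>p\<bar>\<^sup>2\<close> is the real part of a unique polynomial that is real at 0; this operator
  is that polynomial evaluated at \<open>T\<close>. The exponent is \<open>\<bar>i - j\<bar>\<close>, written
  with truncated subtraction.
\<close>

definition toep :: "('a::real_vector \<Rightarrow> 'a) \<Rightarrow> (nat \<Rightarrow> real) \<Rightarrow> nat \<Rightarrow> 'a \<Rightarrow> 'a" where
  "toep T a N v = (\<Sum>i<N. \<Sum>j<N. (a i * a j) *\<^sub>R (T ^^ ((i - j) + (j - i))) v)"

lemma linear_funpow:
  fixes T :: "'a::real_vector \<Rightarrow> 'a"
  shows "linear T \<Longrightarrow> linear (T ^^ k)"
  by (induction k) (simp_all only: funpow.simps linear_id linear_compose)

lemma linear_toep:
  assumes "linear T" shows "linear (toep T a N)"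
proof -
  have "linear (\<lambda>v. \<Sum>i<N. \<Sum>j<N. (a i * a j) *\<^sub>R (T ^^ ((i - j) + (j - i))) v)"
    by (intro linear_compose_sum ballI linear_compose_scale_right linear_funpow assms)
  then show ?thesis by (simp add: toep_def[abs_def])
qed

lemma toep_commute:
  assumes "linear T"
  shows "(T ^^ k) (toep T a N v) = toep T a N ((T ^^ k) v)"
proof -
  interpret Tk: linear "T ^^ k" by (rule linear_funpow[OF assms])
  have "(T ^^ k) ((T ^^ d) v) = (T ^^ d) ((T ^^ k) v)" for d
    by (metis add.commute comp_apply funpow_add)
  then show ?thesis
    by (simp add: toep_def Tk.sum Tk.scale)
qed

lemma toep_in_subspace:
  assumes "subspace S" "\<And>v. v \<in> S \<Longrightarrow> T v \<in> S" "v \<in> S"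
  shows "toep T a N v \<in> S"
proof -
  have "(T ^^ k) v \<in> S" for k
    by (induction k) (use assms in auto)
  then show ?thesis
    unfolding toep_def by (intro subspace_sum subspace_scale assms(1))
qed

lemma toep_Suc:
  "toep T a (Suc N) v
    = toep T a N v + (2::real) *\<^sub>R (\<Sum>i<N. (a i * a N) *\<^sub>R (T ^^ (N - i)) v) + (a N)\<^sup>2 *\<^sub>R v"
proof -
  have 1: "(\<Sum>i<N. (a i * a N) *\<^sub>R (T ^^ ((i - N) + (N - i))) v) = (\<Sum>i<N. (a i * a N) *\<^sub>R (T ^^ (N - i)) v)"
    by (rule sum.cong) auto
  have 2: "(\<Sum>j<N. (a N * a j) *\<^sub>R (T ^^ ((N - j) + (j - N))) v) = (\<Sum>i<N. (a i * a N) *\<^sub>R (T ^^ (N - i)) v)"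
    by (rule sum.cong) (auto simp: mult.commute)
  show ?thesis
    unfolding toep_def sum.lessThan_Suc sum.distrib 1 2
    by (simp add: scaleR_2 power2_eq_square algebra_simps)
qed

text \<open>
  A nonnegative trigonometric polynomial of a contraction has nonnegative real part. The induction on
  \<open>N\<close> carries the Horner sums \<open>s N = \<Sum>i<N. a i T\<^bsup>N-1-i\<^esup> v\<close>, which
  satisfy \<open>s (N + 1) = T (s N) + a N v\<close>: replacing \<open>\<parallel>T (s N)\<parallel>\<close> by
  \<open>\<parallel>s N\<parallel>\<close> in the expansion of \<open>\<parallel>s (N +
  1)\<parallel>\<^sup>2\<close> gives exactly the increment of the form.
\<close>

lemma toep_nonneg:
  fixes S :: "'a::real_inner set"
  assumes T: "linear T" "\<And>v. v \<in> S \<Longrightarrow> T v \<in> S" and contr: "\<And>v. v \<in> S \<Longrightarrow> norm (T v) \<le> norm v"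
    and S: "subspace S" and v: "v \<in> S"
  shows "0 \<le> inner (toep T a N v) v"
proof -
  define s where "s N = (\<Sum>i<N. a i *\<^sub>R (T ^^ (N - 1 - i)) v)" for N
  have pow: "(T ^^ k) v \<in> S" for k
    by (induction k) (use T v in auto)
  have sS: "s N \<in> S" for N
    unfolding s_def by (intro subspace_sum subspace_scale S pow)
  have Ts: "T (s N) = (\<Sum>i<N. a i *\<^sub>R (T ^^ (N - i)) v)" for N
  proof -
    have "T ((T ^^ (N - 1 - i)) v) = (T ^^ (N - i)) v" if "i < N" for i
      using that by (metis Suc_diff_Suc diff_Suc_eq_diff_pred comp_apply funpow.simps(2))
    then show ?thesis
      by (simp add: s_def linear_sum[OF T(1)] linear_scale[OF T(1)])
  qed
  have sSuc: "s (Suc N) = T (s N) + a N *\<^sub>R v" for N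
    by (simp add: Ts) (simp add: s_def)
  have "(norm (s N))\<^sup>2 \<le> inner (toep T a N v) v"
  proof (induction N)
    case 0
    then show ?case by (simp add: s_def toep_def)
  next
    case (Suc N)
    have "(norm (s (Suc N)))\<^sup>2 = (norm (T (s N)))\<^sup>2 + 2 * (a N * inner (T (s N)) v) + (a N)\<^sup>2 * inner v v"
      unfolding sSuc power2_norm_eq_inner
      by (simp add: inner_add_left inner_add_right inner_commute power2_eq_square)
    also have "\<dots> \<le> inner (toep T a N v) v + 2 * (a N * inner (T (s N)) v) + (a N)\<^sup>2 * inner v v"
      using order_trans[OF power_mono[OF contr[OF sS[of N]] norm_ge_zero, of 2] Suc] by simp
    also have "a N * inner (T (s N)) v = inner (\<Sum>i<N. (a i * a N) *\<^sub>R (T ^^ (N - i)) v) v"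
      by (simp add: Ts inner_sum_left sum_distrib_left mult_ac)
    finally show ?case
      by (simp add: toep_Suc inner_add_left)
  qed
  then show ?thesis by (rule order_trans[OF zero_le_power2])
qed

lemma inner_fshift_funpow: "inner ((fshift ^^ k) f) g = inner f ((bshift ^^ k) g)"
  by (induction k arbitrary: g) (simp_all add: inner_fshift funpow_swap1[of bshift])

lemma bshift_fshift_funpow: "(bshift ^^ k) ((fshift ^^ k) f) = f"
  by (rule real_hardy_eqI) (simp add: coef_fshift_funpow)

lemma inner_fshift_fshift:
  assumes "j \<le> i"
  shows "inner ((fshift ^^ i) f) ((fshift ^^ j) g) = inner ((fshift ^^ (i - j)) f) g"
proof -
  have "(fshift ^^ i) f = (fshift ^^ j) ((fshift ^^ (i - j)) f)"
    using assms by (metis comp_apply funpow_add le_add_diff_inverse)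
  then show ?thesis
    by (simp add: inner_fshift_funpow bshift_fshift_funpow)
qed

lemma inner_trunc_mult:
  "inner (trunc_mult x N y) (trunc_mult x N z)
    = (\<Sum>i<N. \<Sum>j<N. coef x i * coef x j * inner ((fshift ^^ i) y) ((fshift ^^ j) z))"
  unfolding trunc_mult_def inner_sum_left
  unfolding inner_sum_right
  by (simp add: mult_ac)

text \<open>
  For the backward shift the form is an exact square, because its adjoint is an isometry: both sides expand into
  the inner products of \<open>z\<^sup>i y\<close> and \<open>z\<^sup>j y\<close>, which depend only on \<open>i
  - j\<close>.
\<close>

lemma inner_toep_bshift: "inner (toep bshift (coef x) N y) y = (norm (trunc_mult x N y))\<^sup>2"
proof -
  have "inner ((bshift ^^ ((i - j) + (j - i))) y) y = inner ((fshift ^^ i) y) ((fshift ^^ j) y)" for i j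
  proof (cases "j \<le> i")
    case True
    then show ?thesis
      using inner_fshift_fshift[of j i y y]
      by (simp add: inner_fshift_funpow[of "i - j"]) (simp add: inner_commute)
  next
    case False
    then show ?thesis
      using inner_fshift_fshift[of i j y y]
      by (simp add: inner_fshift_funpow[of "j - i"]) (simp add: inner_commute)
  qed
  then show ?thesis
    unfolding power2_norm_eq_inner inner_trunc_mult toep_def
    by (simp add: inner_sum_left)
qed

lemma norm_trunc_mult_one_sq: "(norm (trunc_mult x N one_hardy))\<^sup>2 = (\<Sum>i<N. (coef x i)\<^sup>2)"
proof -
  have co: "coef (trunc_mult x N one_hardy) k = (if k < N then coef x k else 0)" for k
  proof -
    have "coef (trunc_mult x N one_hardy) k = (\<Sum>i<N. if i = k then coef x i else 0)"
      unfolding trunc_mult_def coef_sum coef_scaleR coef_fshift_funpow coef_one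
      by (rule sum.cong) auto
    then show ?thesis by simp
  qed
  have "(\<lambda>k. (coef (trunc_mult x N one_hardy) k)\<^sup>2) sums (\<Sum>k<N. (coef (trunc_mult x N one_hardy) k)\<^sup>2)"
    by (rule sums_finite) (auto simp: co)
  from sums_unique2[OF norm_sums this] show ?thesis by (simp add: co)
qed

lemma sum_coef_sq_le: "(\<Sum>i<N. (coef x i)\<^sup>2) \<le> (norm x)\<^sup>2"
  unfolding sums_unique[OF norm_sums[of x]]
  using norm_sums[of x] by (intro sum_le_suminf) (auto simp: sums_iff)

text \<open>
  The quadratic form controls \<open>toep bshift (coef x) N z\<close> only when tested against \<open>z\<close>
  itself. Its constant coefficient is the exception: testing against 1, the terms with \<open>j < i\<close> of
  the polarized form vanish, so twice the polarized form is this coefficient up to a diagonal term. This is how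
  smallness of the form is passed on to coefficients.
\<close>

lemma coef_toep_bshift_0:
  "coef (toep bshift (coef x) N z) 0
    = 2 * inner (trunc_mult x N z) (trunc_mult x N one_hardy) - (\<Sum>i<N. (coef x i)\<^sup>2) * coef z 0"
proof -
  let ?F = "\<lambda>i j. inner ((fshift ^^ i) z) ((fshift ^^ j) one_hardy)"
  have "coef ((bshift ^^ ((i - j) + (j - i))) z) 0 = ?F i j + ?F j i - (if i = j then coef z 0 else 0)"
    for i j
  proof -
    have 1: "?F i j = coef z (j - i)" if "i \<le> j" for i j
      using that inner_fshift_fshift[of i j one_hardy z]
      by (simp add: inner_commute[of _ "(fshift ^^ j) one_hardy"])
        (simp add: inner_commute coef_eq_inner)
    have 2: "?F i j = 0" if "j < i" for i j
      using that inner_fshift_fshift[of j i z one_hardy]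
      by (simp add: inner_one coef_fshift_funpow)
    show ?thesis
      using 1[of i j] 1[of j i] 2[of i j] 2[of j i] by (cases i j rule: linorder_cases) auto
  qed
  then have "coef (toep bshift (coef x) N z) 0
      = (\<Sum>i<N. \<Sum>j<N. coef x i * coef x j * (?F i j + ?F j i - (if i = j then coef z 0 else 0)))"
    by (simp add: toep_def)
  also have "\<dots> = (\<Sum>i<N. \<Sum>j<N. coef x i * coef x j * ?F i j) + (\<Sum>i<N. \<Sum>j<N. coef x i * coef x j * ?F j i)
      - (\<Sum>i<N. \<Sum>j<N. coef x i * coef x j * (if i = j then coef z 0 else 0))"
    by (simp only: distrib_left right_diff_distrib sum.distrib sum_subtractf)
  also have "(\<Sum>i<N. \<Sum>j<N. coef x i * coef x j * ?F j i) = (\<Sum>i<N. \<Sum>j<N. coef x i * coef x j * ?F i j)"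
    by (rule trans[OF sum.swap]) (simp add: mult.commute mult.left_commute)
  also have "(\<Sum>i<N. \<Sum>j<N. coef x i * coef x j * ?F i j) = inner (trunc_mult x N z) (trunc_mult x N one_hardy)"
    by (simp only: inner_trunc_mult)
  also have "(\<Sum>i<N. \<Sum>j<N. coef x i * coef x j * (if i = j then coef z 0 else 0))
      = (\<Sum>i<N. (coef x i)\<^sup>2) * coef z 0"
    by (simp add: if_distrib sum.delta power2_eq_square sum_distrib_right cong: if_cong)
  finally show ?thesis by simp
qed

lemma coef_toep_bshift_0_le:
  "\<bar>coef (toep bshift (coef x) N z) 0\<bar>
    \<le> 2 * (norm (trunc_mult x N z) * norm x) + (norm x)\<^sup>2 * \<bar>coef z 0\<bar>"
proof -
  have "norm (trunc_mult x N one_hardy) \<le> norm x"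
    by (rule power2_le_imp_le) (simp_all add: norm_trunc_mult_one_sq sum_coef_sq_le)
  then have "\<bar>inner (trunc_mult x N z) (trunc_mult x N one_hardy)\<bar> \<le> norm (trunc_mult x N z) * norm x"
    by (intro order_trans[OF Cauchy_Schwarz_ineq2] mult_left_mono) auto
  moreover have "\<bar>(\<Sum>i<N. (coef x i)\<^sup>2) * coef z 0\<bar> \<le> (norm x)\<^sup>2 * \<bar>coef z 0\<bar>"
    unfolding abs_mult by (intro mult_right_mono) (auto simp: sum_nonneg sum_coef_sq_le)
  moreover have "\<bar>2 * a - b\<bar> \<le> 2 * c + d" if "\<bar>a\<bar> \<le> c" "\<bar>b\<bar> \<le> d" for a b c d :: real
    using that by linarith
  ultimately show ?thesis
    unfolding coef_toep_bshift_0 by blast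
qed

lemma coef_trunc_mult:
  assumes "k < N"
  shows "coef (trunc_mult x N y) k = (\<Sum>i\<le>k. coef x i * coef y (k - i))"
proof -
  have "coef (trunc_mult x N y) k = (\<Sum>i<N. if i \<le> k then coef x i * coef y (k - i) else 0)"
    by (auto simp: trunc_mult_def coef_fshift_funpow intro!: sum.cong)
  also have "\<dots> = (\<Sum>i\<in>{i\<in>{..<N}. i \<le> k}. coef x i * coef y (k - i))"
    by (rule sum.inter_filter[symmetric]) simp
  also have "{i\<in>{..<N}. i \<le> k} = {..k}" using assms by auto
  finally show ?thesis .
qed

section \<open>Expansion of a function along a remainder operator\<close>

text \<open>
  One step of the expansion: \<open>f = \<Sum> \<langle>f, \<delta>\<^sub>j\<rangle> w\<^sub>j + z R f\<close>
  with \<open>R f\<close> again in \<open>M\<close>, and the norms add up as if the summands were orthogonal.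
  The scalars are written as inner products with fixed vectors so that \<open>R\<close> is weakly continuous.
\<close>

locale wandering_expansion =
  fixes M :: "real_hardy set" and m :: nat and w \<delta> :: "nat \<Rightarrow> real_hardy"
  assumes subspace_M: "subspace M" and closed_M: "closed M"
    and vanishes: "f \<in> M \<Longrightarrow> coef (f - (\<Sum>j<m. inner f (\<delta> j) *\<^sub>R w j)) 0 = 0"
    and remainder_in: "f \<in> M \<Longrightarrow> bshift (f - (\<Sum>j<m. inner f (\<delta> j) *\<^sub>R w j)) \<in> M"
    and norm_split: "f \<in> M \<Longrightarrow> (norm f)\<^sup>2 = (\<Sum>j<m. (inner f (\<delta> j))\<^sup>2)
        + (norm (bshift (f - (\<Sum>j<m. inner f (\<delta> j) *\<^sub>R w j))))\<^sup>2"
begin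

definition rem :: "real_hardy \<Rightarrow> real_hardy" where
  "rem f = bshift (f - (\<Sum>j<m. inner f (\<delta> j) *\<^sub>R w j))"

lemma linear_rem: "linear rem"
  by (intro linearI real_hardy_eqI)
    (simp_all add: rem_def inner_add_left sum.distrib sum_distrib_left algebra_simps)

lemma rem_in: "f \<in> M \<Longrightarrow> rem f \<in> M"
  unfolding rem_def by (rule remainder_in)

lemma rem_funpow_in: "f \<in> M \<Longrightarrow> (rem ^^ k) f \<in> M"
  by (induction k) (auto intro: rem_in)

lemma norm_rem: "f \<in> M \<Longrightarrow> (norm f)\<^sup>2 = (\<Sum>j<m. (inner f (\<delta> j))\<^sup>2) + (norm (rem f))\<^sup>2"
  unfolding rem_def by (rule norm_split)

lemma norm_rem_le: "f \<in> M \<Longrightarrow> norm (rem f) \<le> norm f"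
  by (rule power2_le_imp_le) (simp_all add: norm_rem sum_nonneg)

lemma norm_rem_funpow_le: "f \<in> M \<Longrightarrow> norm ((rem ^^ k) f) \<le> norm f"
  by (induction k) (auto intro: order_trans[OF norm_rem_le] rem_funpow_in)

lemma expand_once:
  assumes "f \<in> M"
  shows "f = (\<Sum>j<m. inner f (\<delta> j) *\<^sub>R w j) + fshift (rem f)"
  unfolding rem_def fshift_bshift using vanishes[OF assms] by simp

lemma norm_expansion:
  assumes "f \<in> M"
  shows "(norm f)\<^sup>2 = (\<Sum>k<K. \<Sum>j<m. (inner ((rem ^^ k) f) (\<delta> j))\<^sup>2) + (norm ((rem ^^ K) f))\<^sup>2"
proof (induction K)
  case (Suc K)
  then show ?case
    using norm_rem[OF rem_funpow_in[OF assms, of K]] by simp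
qed simp

lemma sum_coordinate_sq_le:
  assumes "f \<in> M" "j < m"
  shows "(\<Sum>k<K. (inner ((rem ^^ k) f) (\<delta> j))\<^sup>2) \<le> (norm f)\<^sup>2"
proof -
  have "(\<Sum>k<K. (inner ((rem ^^ k) f) (\<delta> j))\<^sup>2) \<le> (\<Sum>k<K. \<Sum>j<m. (inner ((rem ^^ k) f) (\<delta> j))\<^sup>2)"
    using assms(2) by (intro sum_mono member_le_sum) auto
  also have "\<dots> \<le> (norm f)\<^sup>2"
    using norm_expansion[OF assms(1), of K] by simp
  finally show ?thesis .
qed

text \<open>
  The series \<open>\<Sum> \<langle>R\<^sup>k f, \<delta>\<^sub>j\<rangle> z\<^sup>k\<close>; for
  \<open>f\<close> in \<open>M\<close> and \<open>j < m\<close> its coefficients are square-summable by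
  \<open>sum_coordinate_sq_le\<close>, so such a series exists.
\<close>

definition coord :: "real_hardy \<Rightarrow> nat \<Rightarrow> real_hardy" where
  "coord f j = (SOME h. \<forall>k. coef h k = inner ((rem ^^ k) f) (\<delta> j))"

lemma coef_coord:
  assumes "f \<in> M" "j < m"
  shows "coef (coord f j) k = inner ((rem ^^ k) f) (\<delta> j)"
proof -
  have "summable (\<lambda>k. (inner ((rem ^^ k) f) (\<delta> j))\<^sup>2)"
    by (rule summableI_nonneg_bounded[OF _ sum_coordinate_sq_le[OF assms]]) auto
  from someI_ex[OF ex_coef_eq[OF this]] show ?thesis
    unfolding coord_def by blast
qed

lemma norm_coord_le:
  assumes "f \<in> M" "j < m"
  shows "norm (coord f j) \<le> norm f"
proof (rule power2_le_imp_le)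
  have "(norm (coord f j))\<^sup>2 = (\<Sum>k. (inner ((rem ^^ k) f) (\<delta> j))\<^sup>2)"
    using sums_unique[OF norm_sums[of "coord f j"]] by (simp add: coef_coord[OF assms])
  also have "\<dots> \<le> (norm f)\<^sup>2"
    by (intro suminf_le_const sum_coordinate_sq_le assms
        summableI_nonneg_bounded[OF _ sum_coordinate_sq_le[OF assms]]) auto
  finally show "(norm (coord f j))\<^sup>2 \<le> (norm f)\<^sup>2" .
qed simp

lemma coord_rem_funpow:
  assumes "f \<in> M" "j < m"
  shows "coord ((rem ^^ K) f) j = (bshift ^^ K) (coord f j)"
  by (rule real_hardy_eqI)
    (simp add: coef_coord assms rem_funpow_in funpow_add[symmetric, THEN fun_cong, simplified comp_apply] add.commute)

lemma coord_rem: "f \<in> M \<Longrightarrow> j < m \<Longrightarrow> coord (rem f) j = bshift (coord f j)"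
  using coord_rem_funpow[of f j 1] by simp

lemma coord_add:
  assumes "f \<in> M" "g \<in> M" "j < m"
  shows "coord (f + g) j = coord f j + coord g j"
  using assms by (intro real_hardy_eqI)
    (simp add: coef_coord subspace_add[OF subspace_M] linear_add[OF linear_funpow[OF linear_rem]] inner_add_left)

lemma coord_diff:
  assumes "f \<in> M" "g \<in> M" "j < m"
  shows "coord (f - g) j = coord f j - coord g j"
  using assms by (intro real_hardy_eqI)
    (simp add: coef_coord subspace_diff[OF subspace_M] linear_diff[OF linear_funpow[OF linear_rem]] inner_diff_left)

lemma coord_scale:
  assumes "f \<in> M" "j < m"
  shows "coord (c *\<^sub>R f) j = c *\<^sub>R coord f j"
  using assms by (intro real_hardy_eqI)
    (simp add: coef_coord subspace_scale[OF subspace_M] linear_scale[OF linear_funpow[OF linear_rem]])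

text \<open>
  After \<open>k + 1\<close> steps the remainder carries the factor \<open>z\<^bsup>k+1\<^esup>\<close> and no longer
  contributes to the coefficient of \<open>z\<^sup>k\<close>, so this identity needs no convergence in norm.
\<close>

lemma coef_expansion:
  assumes "f \<in> M"
  shows "coef f k = (\<Sum>j<m. \<Sum>i\<le>k. coef (coord f j) i * coef (w j) (k - i))"
  using assms
proof (induction k arbitrary: f)
  case 0
  have "coef f 0 = coef ((\<Sum>j<m. inner f (\<delta> j) *\<^sub>R w j) + fshift (rem f)) 0"
    using expand_once[OF 0] by simp
  then show ?case by (simp add: coef_coord[OF 0])
next
  case (Suc k)
  have "coef f (Suc k) = coef ((\<Sum>j<m. inner f (\<delta> j) *\<^sub>R w j) + fshift (rem f)) (Suc k)"
    using expand_once[OF Suc.prems] by simp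
  also have "\<dots> = (\<Sum>j<m. inner f (\<delta> j) * coef (w j) (Suc k))
      + (\<Sum>j<m. \<Sum>i\<le>k. coef (coord (rem f) j) i * coef (w j) (k - i))"
    using Suc.IH[OF rem_in[OF Suc.prems]] by simp
  also have "\<dots> = (\<Sum>j<m. \<Sum>i\<le>Suc k. coef (coord f j) i * coef (w j) (Suc k - i))"
    unfolding sum.distrib[symmetric] sum.atMost_Suc_shift
    using Suc.prems by (intro sum.cong) (simp_all add: coef_coord[where k = 0] coord_rem)
  finally show ?case .
qed

lemma series_expansion:
  assumes "f \<in> M"
  shows "series f = (\<Sum>j<m. series (coord f j) * series (w j))"
  by (rule fps_ext)
    (simp add: fps_nth_series coef_expansion[OF assms] fps_sum_nth fps_mult_nth atMost_atLeast0)

lemma eq_zero_if_coord_zero: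
  assumes "f \<in> M" "\<And>j. j < m \<Longrightarrow> coord f j = 0"
  shows "f = 0"
  by (rule real_hardy_eqI) (simp add: coef_expansion[OF assms(1)] assms(2))

lemma norm_eq_if_stable:
  assumes f: "f \<in> M" and stable: "(\<lambda>K. norm ((rem ^^ K) f)) \<longlonglongrightarrow> 0"
  shows "(norm f)\<^sup>2 = (\<Sum>j<m. (norm (coord f j))\<^sup>2)"
proof (rule LIMSEQ_unique)
  have "(\<lambda>K. \<Sum>j<m. \<Sum>k<K. (coef (coord f j) k)\<^sup>2) \<longlonglongrightarrow> (\<Sum>j<m. (norm (coord f j))\<^sup>2)"
    by (intro tendsto_sum norm_sums[unfolded sums_def])
  moreover have "(\<Sum>j<m. \<Sum>k<K. (coef (coord f j) k)\<^sup>2)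
      = (\<Sum>k<K. \<Sum>j<m. (inner ((rem ^^ k) f) (\<delta> j))\<^sup>2)" for K
    by (subst sum.swap) (simp add: coef_coord[OF f])
  ultimately show "(\<lambda>K. \<Sum>k<K. \<Sum>j<m. (inner ((rem ^^ k) f) (\<delta> j))\<^sup>2)
      \<longlonglongrightarrow> (\<Sum>j<m. (norm (coord f j))\<^sup>2)" by simp
  have "(\<lambda>K. (norm f)\<^sup>2 - (norm ((rem ^^ K) f))\<^sup>2) \<longlonglongrightarrow> (norm f)\<^sup>2 - 0\<^sup>2"
    by (intro tendsto_diff tendsto_power stable tendsto_const)
  moreover have "(norm f)\<^sup>2 - (norm ((rem ^^ K) f))\<^sup>2
      = (\<Sum>k<K. \<Sum>j<m. (inner ((rem ^^ k) f) (\<delta> j))\<^sup>2)" for K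
    using norm_expansion[OF f, of K] by simp
  ultimately show "(\<lambda>K. \<Sum>k<K. \<Sum>j<m. (inner ((rem ^^ k) f) (\<delta> j))\<^sup>2) \<longlonglongrightarrow> (norm f)\<^sup>2"
    by simp
qed

section \<open>Stability of the remainder\<close>

text \<open>
  The polynomial, real at 0, whose real part on the circle is \<open>\<Sum>l<m.
  \<bar>w\<^sub>l\<bar>\<^sup>2\<close>, with the \<open>w\<^sub>l\<close> truncated at \<open>N\<close>,
  evaluated at \<open>T\<close>.
\<close>

definition symbol_op :: "(real_hardy \<Rightarrow> real_hardy) \<Rightarrow> nat \<Rightarrow> real_hardy \<Rightarrow> real_hardy" where
  "symbol_op T N v = (\<Sum>l<m. toep T (coef (w l)) N v)"

lemma linear_symbol_op: "linear T \<Longrightarrow> linear (symbol_op T N)"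
  unfolding symbol_op_def[abs_def] by (intro linear_compose_sum ballI linear_toep)

lemma symbol_op_in: "v \<in> M \<Longrightarrow> symbol_op rem N v \<in> M"
  unfolding symbol_op_def
  by (intro subspace_sum toep_in_subspace subspace_M rem_in)

lemma symbol_op_commute:
  assumes "linear T"
  shows "(T ^^ k) (symbol_op T N v) = symbol_op T N ((T ^^ k) v)"
proof -
  interpret Tk: linear "T ^^ k" by (rule linear_funpow[OF assms])
  show ?thesis
    by (simp add: symbol_op_def Tk.sum toep_commute[OF assms])
qed

lemma coord_symbol_op:
  assumes "v \<in> M" "j < m"
  shows "coord (symbol_op rem N v) j = symbol_op bshift N (coord v j)"
proof (rule real_hardy_eqI)
  fix k
  have "coef (coord (symbol_op rem N v) j) k = inner (symbol_op rem N ((rem ^^ k) v)) (\<delta> j)"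
    by (simp add: coef_coord[OF symbol_op_in] assms symbol_op_commute[OF linear_rem])
  also have "\<dots> = coef (symbol_op bshift N (coord v j)) k"
    by (simp add: symbol_op_def toep_def inner_sum_left coef_coord assms
        funpow_add[symmetric, THEN fun_cong, simplified comp_apply])
  finally show "coef (coord (symbol_op rem N v) j) k = coef (symbol_op bshift N (coord v j)) k" .
qed

text \<open>
  The operator is bounded on \<open>M\<close> as a polynomial in a contraction, and coercive because
  \<open>toep_nonneg\<close> makes the symbol term nonnegative.
\<close>

lemma symbol_equation_solvable:
  assumes f: "f \<in> M"
  shows "\<exists>v\<in>M. v + symbol_op rem N v = f"
proof (rule coercive_equation_solvable[OF subspace_M closed_M _ _ _ _ f])
  show "linear (\<lambda>v. v + symbol_op rem N v)"
    by (intro linear_compose_add linear_ident linear_symbol_op linear_rem)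
  show "(\<lambda>v. v + symbol_op rem N v) ` M \<subseteq> M"
    by (auto intro: subspace_add[OF subspace_M] symbol_op_in)
  fix v assume v: "v \<in> M"
  define C where "C = 1 + (\<Sum>l<m. \<Sum>i<N. \<Sum>j<N. \<bar>coef (w l) i * coef (w l) j\<bar>)"
  have "norm (symbol_op rem N v) \<le> (\<Sum>l<m. \<Sum>i<N. \<Sum>j<N. \<bar>coef (w l) i * coef (w l) j\<bar> * norm v)"
    unfolding symbol_op_def toep_def
    by (intro order_trans[OF norm_sum] sum_mono)
      (auto intro!: mult_left_mono norm_rem_funpow_le v)
  then show "norm (v + symbol_op rem N v) \<le> C * norm v"
    unfolding C_def distrib_right sum_distrib_right mult_1_left
    by (intro order_trans[OF norm_triangle_ineq] add_left_mono)
  have "0 \<le> inner (symbol_op rem N v) v"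
    unfolding symbol_op_def inner_sum_left
    by (intro sum_nonneg toep_nonneg[OF linear_rem rem_in norm_rem_le subspace_M v])
  then show "(norm v)\<^sup>2 \<le> inner (v + symbol_op rem N v) v"
    by (simp add: inner_add_left power2_norm_eq_inner)
qed


lemma inner_rem: "inner (rem f) x = inner f (fshift x) - (\<Sum>j<m. inner f (\<delta> j) * inner (bshift (w j)) x)"
  by (simp add: rem_def linear_diff[OF linear_bshift] linear_sum[OF linear_bshift]
      linear_scale[OF linear_bshift] inner_diff_left inner_sum_left inner_fshift_right)

lemma rem_funpow_weakly_continuous:
  assumes "\<And>x. (\<lambda>N. inner (v N) x) \<longlonglongrightarrow> inner u x"
  shows "(\<lambda>N. inner ((rem ^^ K) (v N)) x) \<longlonglongrightarrow> inner ((rem ^^ K) u) x"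
proof (induction K arbitrary: x)
  case (Suc K)
  then show ?case
    by (simp add: inner_rem) (intro tendsto_intros Suc)
qed (use assms in simp)

lemma symbol_equation_coord:
  assumes v: "v \<in> M" and j: "j < m"
  shows "(bshift ^^ K) (coord (v + symbol_op rem N v) j)
    = (bshift ^^ K) (coord v j) + symbol_op bshift N ((bshift ^^ K) (coord v j))"
  using assms
  by (simp add: coord_add symbol_op_in coord_symbol_op symbol_op_commute[OF linear_bshift]
      linear_add[OF linear_funpow[OF linear_bshift]])

text \<open>
  The gain from the symbol: pairing the equation for the coordinates with its solution bounds all products
  \<open>w\<^sub>l y\<close> by \<open>u\<close>, uniformly in the truncation. The power \<open>K\<close> is
  free because everything commutes with the backward shift.
\<close>

lemma symbol_equation_energy:
  assumes v: "v \<in> M" and j: "j < m" and y: "y = (bshift ^^ K) (coord v j)"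
    and u: "u = (bshift ^^ K) (coord (v + symbol_op rem N v) j)"
  shows "(norm y)\<^sup>2 + (\<Sum>l<m. (norm (trunc_mult (w l) N y))\<^sup>2) = inner u y"
  unfolding u symbol_equation_coord[OF v j] y[symmetric]
  by (simp add: inner_add_left symbol_op_def inner_sum_left inner_toep_bshift power2_norm_eq_inner)

lemma trunc_mult_solution_le:
  assumes v: "v \<in> M" and j: "j < m" and y: "y = (bshift ^^ K) (coord v j)"
    and u: "u = (bshift ^^ K) (coord (v + symbol_op rem N v) j)" and l: "l < m"
  shows "(norm (trunc_mult (w l) N y))\<^sup>2 \<le> norm u * norm y" and "norm y \<le> norm u"
proof -
  note energy = symbol_equation_energy[OF v j y u]
  have uy: "inner u y \<le> norm u * norm y" by (rule norm_cauchy_schwarz)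
  have "(norm (trunc_mult (w l) N y))\<^sup>2 \<le> (\<Sum>l<m. (norm (trunc_mult (w l) N y))\<^sup>2)"
    using l by (intro member_le_sum) auto
  moreover have "0 \<le> (norm y)\<^sup>2" by simp
  ultimately show "(norm (trunc_mult (w l) N y))\<^sup>2 \<le> norm u * norm y"
    using energy uy by linarith
  have "(norm y)\<^sup>2 \<le> norm u * norm y"
    using energy uy sum_nonneg[of "{..<m}" "\<lambda>l. (norm (trunc_mult (w l) N y))\<^sup>2"] by simp
  then show "norm y \<le> norm u"
    by (cases "norm y = 0") (auto simp: power2_eq_square)
qed

lemma trunc_mult_solution_norm_le:
  assumes v: "v \<in> M" and j: "j < m" and y: "y = (bshift ^^ K) (coord v j)"
    and u: "u = (bshift ^^ K) (coord (v + symbol_op rem N v) j)" and l: "l < m"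
  shows "norm (trunc_mult (w l) N y) \<le> norm u"
proof (rule power2_le_imp_le)
  have "(norm (trunc_mult (w l) N y))\<^sup>2 \<le> norm u * norm y"
    by (rule trunc_mult_solution_le(1)[OF assms])
  also have "\<dots> \<le> norm u * norm u"
    by (intro mult_left_mono trunc_mult_solution_le(2)[OF assms]) simp
  finally show "(norm (trunc_mult (w l) N y))\<^sup>2 \<le> (norm u)\<^sup>2"
    by (simp add: power2_eq_square)
qed simp

text \<open>
  By \<open>trunc_mult_solution_norm_le\<close> the truncated versions of \<open>R\<^sup>K v\<^sub>N\<close>,
  assembled from the products of the truncated generators with the coordinates, have norms at most
  \<open>\<Sum>j. \<parallel>B\<^sup>K (coord f j)\<parallel>\<close> for every \<open>N\<close>. Each
  coefficient involves only finitely many coefficients of the generators, so the truncation disappears in the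
  limit, and the bound, which tends to 0 with \<open>K\<close>, survives by Fatou's lemma.
\<close>

lemma weak_limit_of_solutions_stable:
  assumes v: "\<And>N. v N \<in> M" "\<And>N. v N + symbol_op rem N (v N) = f"
    and r: "strict_mono (r :: nat \<Rightarrow> nat)"
    and lim: "\<And>x. (\<lambda>N. inner (v (r N)) x) \<longlonglongrightarrow> inner u x"
    and u: "u \<in> M"
  shows "(\<lambda>K. norm ((rem ^^ K) u)) \<longlonglongrightarrow> 0"
proof -
  have bound: "norm ((rem ^^ K) u) \<le> (\<Sum>j<m. norm ((bshift ^^ K) (coord f j)))" for K
  proof -
    define y where "y N j = (bshift ^^ K) (coord (v (r N)) j)" for N j
    define s where "s N = (\<Sum>j<m. trunc_mult (w j) (r N) (y N j))" for N
    have "norm (s N) \<le> (\<Sum>j<m. norm ((bshift ^^ K) (coord f j)))" for N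
    proof -
      have "norm (trunc_mult (w j) (r N) (y N j)) \<le> norm ((bshift ^^ K) (coord f j))" if "j < m" for j
      proof -
        have "(bshift ^^ K) (coord f j)
            = (bshift ^^ K) (coord (v (r N) + symbol_op rem (r N) (v (r N))) j)"
          by (simp only: v(2))
        from trunc_mult_solution_norm_le[OF v(1) that y_def this that] show ?thesis .
      qed
      then show ?thesis
        unfolding s_def by (intro order_trans[OF norm_sum] sum_mono) auto
    qed
    moreover have "(\<lambda>N. coef (s N) k) \<longlonglongrightarrow> coef ((rem ^^ K) u) k" for k
    proof -
      have y_lim: "(\<lambda>N. coef (y N j) i) \<longlonglongrightarrow> coef (coord ((rem ^^ K) u) j) i" if "j < m" for j i
        using that rem_funpow_weakly_continuous[OF lim, of "i + K" "\<delta> j"]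
        by (simp add: y_def coord_rem_funpow[symmetric] coef_coord rem_funpow_in v(1) u funpow_add
            del: coef_bshift_funpow)
      have "(\<lambda>N. \<Sum>j<m. \<Sum>i\<le>k. coef (w j) i * coef (y N j) (k - i))
          \<longlonglongrightarrow> (\<Sum>j<m. \<Sum>i\<le>k. coef (w j) i * coef (coord ((rem ^^ K) u) j) (k - i))"
        by (intro tendsto_sum tendsto_mult tendsto_const y_lim) simp
      also have "(\<Sum>j<m. \<Sum>i\<le>k. coef (w j) i * coef (coord ((rem ^^ K) u) j) (k - i)) = coef ((rem ^^ K) u) k"
        unfolding coef_expansion[OF rem_funpow_in[OF u]]
        by (intro sum.cong refl sum.reindex_bij_witness[where i = "\<lambda>i. k - i" and j = "\<lambda>i. k - i"])
          (auto simp: mult.commute)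
      finally have "(\<lambda>N. \<Sum>j<m. \<Sum>i\<le>k. coef (w j) i * coef (y N j) (k - i)) \<longlonglongrightarrow> coef ((rem ^^ K) u) k" .
      moreover have "\<forall>\<^sub>F N in sequentially.
          (\<Sum>j<m. \<Sum>i\<le>k. coef (w j) i * coef (y N j) (k - i)) = coef (s N) k"
        using eventually_gt_at_top[of k]
      proof eventually_elim
        case (elim N)
        then have "k < r N" using seq_suble[OF r, of N] by simp
        then show ?case by (simp add: s_def coef_trunc_mult)
      qed
      ultimately show ?thesis by (rule Lim_transform_eventually)
    qed
    ultimately show ?thesis
      using coef_limit_Fatou[OF _ tendsto_const] real_hardy_eqI by metis
  qed
  have "(\<lambda>K. \<Sum>j<m. norm ((bshift ^^ K) (coord f j))) \<longlonglongrightarrow> (\<Sum>j<m. 0)"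
    by (intro tendsto_sum norm_bshift_funpow_tendsto_0)
  then have "(\<lambda>K. \<Sum>j<m. norm ((bshift ^^ K) (coord f j))) \<longlonglongrightarrow> 0" by simp
  from tendsto_sandwich[OF _ _ tendsto_const this] show ?thesis
    using bound by simp
qed

text \<open>
  If the solutions tend to 0 in norm, the energy identity makes the products \<open>w\<^sub>l y\<close> tend to
  0 as well, although the operators in the equation are not uniformly bounded. The constant coefficient of the
  equation is controlled by these products, and the \<open>k\<close>-th coefficient is the constant one after
  \<open>k\<close> backward shifts.
\<close>

lemma vanishing_solutions:
  assumes v: "\<And>N. v N \<in> M" "\<And>N. v N + symbol_op rem N (v N) = f" and f: "f \<in> M"
    and r: "strict_mono (r :: nat \<Rightarrow> nat)" and lim: "(\<lambda>N. norm (v (r N))) \<longlonglongrightarrow> 0"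
  shows "f = 0"
proof (rule eq_zero_if_coord_zero[OF f], rule real_hardy_eqI)
  fix j k assume j: "j < m"
  define y where "y N = (bshift ^^ k) (coord (v (r N)) j)" for N
  define u where "u = (bshift ^^ k) (coord f j)"
  have y_lim: "(\<lambda>N. norm (y N)) \<longlonglongrightarrow> 0"
  proof (rule tendsto_sandwich[OF _ _ tendsto_const lim])
    have "norm (y N) \<le> norm (v (r N))" for N
    proof -
      have "y N = coord ((rem ^^ k) (v (r N))) j"
        by (simp add: y_def coord_rem_funpow v(1) j)
      then show ?thesis
        using norm_coord_le[OF rem_funpow_in[OF v(1)] j] norm_rem_funpow_le[OF v(1)] order_trans
        by metis
    qed
    then show "\<forall>\<^sub>F N in sequentially. norm (y N) \<le> norm (v (r N))" by simp
  qed simp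
  have t_lim: "(\<lambda>N. norm (trunc_mult (w l) (r N) (y N))) \<longlonglongrightarrow> 0" if l: "l < m" for l
  proof -
    have "(\<lambda>N. (norm (trunc_mult (w l) (r N) (y N)))\<^sup>2) \<longlonglongrightarrow> 0"
    proof (rule tendsto_sandwich[OF _ _ tendsto_const])
      show "(\<lambda>N. norm u * norm (y N)) \<longlonglongrightarrow> 0"
        using tendsto_mult[OF tendsto_const y_lim] by simp
      show "\<forall>\<^sub>F N in sequentially. (norm (trunc_mult (w l) (r N) (y N)))\<^sup>2 \<le> norm u * norm (y N)"
      proof (intro always_eventually allI)
        fix N
        have "u = (bshift ^^ k) (coord (v (r N) + symbol_op rem (r N) (v (r N))) j)"
          by (simp only: v(2) u_def)
        from trunc_mult_solution_le(1)[OF v(1) j y_def this l]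
        show "(norm (trunc_mult (w l) (r N) (y N)))\<^sup>2 \<le> norm u * norm (y N)" .
      qed
    qed simp
    from tendsto_real_sqrt[OF this] show ?thesis by simp
  qed
  have bound: "\<bar>coef u 0\<bar> \<le> norm (y N) + (\<Sum>l<m. 2 * (norm (trunc_mult (w l) (r N) (y N)) * norm (w l))
      + (norm (w l))\<^sup>2 * norm (y N))" for N
  proof -
    have "u = y N + symbol_op bshift (r N) (y N)"
      using symbol_equation_coord[OF v(1) j, of k "r N" "r N"] by (simp add: u_def y_def v(2))
    then have "\<bar>coef u 0\<bar> \<le> \<bar>coef (y N) 0\<bar> + \<bar>\<Sum>l<m. coef (toep bshift (coef (w l)) (r N) (y N)) 0\<bar>"
      by (simp add: symbol_op_def)
    also have "\<dots> \<le> norm (y N) + (\<Sum>l<m. 2 * (norm (trunc_mult (w l) (r N) (y N)) * norm (w l))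
      + (norm (w l))\<^sup>2 * norm (y N))"
      by (intro add_mono coef_le_norm order_trans[OF sum_abs] sum_mono
          order_trans[OF coef_toep_bshift_0_le] mult_left_mono order_refl) auto
    finally show ?thesis .
  qed
  have "(\<lambda>N. norm (y N) + (\<Sum>l<m. 2 * (norm (trunc_mult (w l) (r N) (y N)) * norm (w l))
      + (norm (w l))\<^sup>2 * norm (y N))) \<longlonglongrightarrow> 0 + (\<Sum>l<m. 2 * (0 * norm (w l)) + (norm (w l))\<^sup>2 * 0)"
    by (intro tendsto_add tendsto_sum tendsto_mult tendsto_const y_lim t_lim) auto
  then have "\<bar>coef u 0\<bar> \<le> 0 + (\<Sum>l<m. 2 * (0 * norm (w l)) + (norm (w l))\<^sup>2 * 0)"
    by (rule LIMSEQ_le_const) (use bound in blast)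
  then show "coef (coord f j) k = coef 0 k"
    by (simp add: u_def)
qed

lemma subspace_stable: "subspace {f \<in> M. (\<lambda>K. norm ((rem ^^ K) f)) \<longlonglongrightarrow> 0}"
proof (rule subspaceI)
  show "0 \<in> {f \<in> M. (\<lambda>K. norm ((rem ^^ K) f)) \<longlonglongrightarrow> 0}"
    by (simp add: subspace_0[OF subspace_M] linear_0[OF linear_funpow[OF linear_rem]])
next
  fix f g
  assume *: "f \<in> {f \<in> M. (\<lambda>K. norm ((rem ^^ K) f)) \<longlonglongrightarrow> 0}" "g \<in> {f \<in> M. (\<lambda>K. norm ((rem ^^ K) f)) \<longlonglongrightarrow> 0}"
  then have "(\<lambda>K. (rem ^^ K) f + (rem ^^ K) g) \<longlonglongrightarrow> 0 + 0"
    by (intro tendsto_add) (simp_all add: tendsto_norm_zero_iff)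
  then show "f + g \<in> {f \<in> M. (\<lambda>K. norm ((rem ^^ K) f)) \<longlonglongrightarrow> 0}"
    using * by (simp add: subspace_add[OF subspace_M] linear_add[OF linear_funpow[OF linear_rem]]
        tendsto_norm_zero_iff)
next
  fix c :: real and f
  assume *: "f \<in> {f \<in> M. (\<lambda>K. norm ((rem ^^ K) f)) \<longlonglongrightarrow> 0}"
  then have "(\<lambda>K. c *\<^sub>R (rem ^^ K) f) \<longlonglongrightarrow> c *\<^sub>R 0"
    by (intro tendsto_scaleR tendsto_const) (simp add: tendsto_norm_zero_iff)
  then show "c *\<^sub>R f \<in> {f \<in> M. (\<lambda>K. norm ((rem ^^ K) f)) \<longlonglongrightarrow> 0}"
    using * by (simp only: mem_Collect_eq subspace_scale[OF subspace_M] linear_scale[OF linear_funpow[OF linear_rem]]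
        tendsto_norm_zero_iff scaleR_zero_right)
qed

lemma closed_stable: "closed {f \<in> M. (\<lambda>K. norm ((rem ^^ K) f)) \<longlonglongrightarrow> 0}"
proof (rule closed_sequential_limits[THEN iffD2], intro allI impI, elim conjE)
  fix s f assume s: "\<forall>n. s n \<in> {f \<in> M. (\<lambda>K. norm ((rem ^^ K) f)) \<longlonglongrightarrow> 0}" and lim: "s \<longlonglongrightarrow> f"
  then have sM: "s n \<in> M" for n by simp
  then have f: "f \<in> M" using closed_sequentially[OF closed_M _ lim] by blast
  have "(\<lambda>K. norm ((rem ^^ K) f)) \<longlonglongrightarrow> 0"
  proof (rule LIMSEQ_I)
    fix e :: real assume e: "0 < e"
    obtain n where n: "norm (s n - f) < e / 2"
      using LIMSEQ_D[OF lim half_gt_zero[OF e]] by blast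
    have "(\<lambda>K. norm ((rem ^^ K) (s n))) \<longlonglongrightarrow> 0" using s by simp
    from LIMSEQ_D[OF this half_gt_zero[OF e]]
    obtain K0 where K0: "\<And>K. K \<ge> K0 \<Longrightarrow> norm ((rem ^^ K) (s n)) < e / 2" by auto
    have "norm ((rem ^^ K) f) < e" if "K \<ge> K0" for K
    proof -
      have "(rem ^^ K) f = (rem ^^ K) (s n) - (rem ^^ K) (s n - f)"
        by (simp add: linear_diff[OF linear_funpow[OF linear_rem]])
      then have "norm ((rem ^^ K) f) \<le> norm ((rem ^^ K) (s n)) + norm ((rem ^^ K) (s n - f))"
        by (simp only: norm_triangle_ineq4)
      moreover have "norm ((rem ^^ K) (s n - f)) \<le> norm (s n - f)"
        by (intro norm_rem_funpow_le subspace_diff[OF subspace_M] sM f)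
      ultimately show ?thesis using K0[OF that] n by linarith
    qed
    then show "\<exists>K0. \<forall>K\<ge>K0. norm (norm ((rem ^^ K) f) - 0) < e" by auto
  qed
  with f show "f \<in> {f \<in> M. (\<lambda>K. norm ((rem ^^ K) f)) \<longlonglongrightarrow> 0}" by simp
qed

text \<open>
  The component \<open>q\<close> of \<open>f\<close> orthogonal to the stable functions is orthogonal to the
  weak limit of the smoothed versions of \<open>q\<close>, which is stable. Hence these tend to 0 in norm along
  a subsequence, which is possible only for \<open>q = 0\<close>.
\<close>

lemma remainder_stable:
  assumes "f \<in> M"
  shows "(\<lambda>K. norm ((rem ^^ K) f)) \<longlonglongrightarrow> 0"
proof -
  let ?S = "{f \<in> M. (\<lambda>K. norm ((rem ^^ K) f)) \<longlonglongrightarrow> 0}"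
  obtain p where p: "p \<in> ?S" and orth: "\<And>s. s \<in> ?S \<Longrightarrow> inner (f - p) s = 0"
    using orthogonal_projection_exists[OF subspace_stable closed_stable] by blast
  define q where "q = f - p"
  have q: "q \<in> M" using p assms by (auto simp: q_def intro: subspace_diff[OF subspace_M])
  have "\<forall>N. \<exists>v. v \<in> M \<and> v + symbol_op rem N v = q"
    using symbol_equation_solvable[OF q] by blast
  from choice[OF this] obtain v where v: "\<And>N. v N \<in> M" "\<And>N. v N + symbol_op rem N (v N) = q"
    by blast
  have energy: "(norm (v N))\<^sup>2 \<le> inner q (v N)" for N
  proof -
    have "0 \<le> inner (symbol_op rem N (v N)) (v N)"
      unfolding symbol_op_def inner_sum_left
      by (intro sum_nonneg toep_nonneg[OF linear_rem rem_in norm_rem_le subspace_M v(1)])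
    then show ?thesis
      using arg_cong[OF v(2), of "\<lambda>x. inner x (v N)" N]
      by (simp add: inner_add_left power2_norm_eq_inner)
  qed
  have bound: "norm (v N) \<le> norm q" for N
  proof -
    have "(norm (v N))\<^sup>2 \<le> norm q * norm (v N)"
      using energy[of N] norm_cauchy_schwarz order_trans by blast
    then show ?thesis by (cases "norm (v N) = 0") (auto simp: power2_eq_square)
  qed
  from bounded_imp_weak_subseq[of v, OF bound]
  obtain r u where r: "strict_mono r" and lim: "\<And>x. (\<lambda>N. inner (v (r N)) x) \<longlonglongrightarrow> inner u x"
    by blast
  have u: "u \<in> M"
    by (rule weak_limit_in_closed_subspace[OF subspace_M closed_M v(1) lim])
  have "inner q u = 0"
    unfolding q_def
    by (rule orth) (use u weak_limit_of_solutions_stable[OF v r lim u] in simp)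
  then have "(\<lambda>N. inner q (v (r N))) \<longlonglongrightarrow> 0"
    using lim[of q] by (simp add: inner_commute)
  from tendsto_sandwich[OF _ _ tendsto_const this, of "\<lambda>N. (norm (v (r N)))\<^sup>2"]
  have "(\<lambda>N. (norm (v (r N)))\<^sup>2) \<longlonglongrightarrow> 0"
    using energy by simp
  from tendsto_real_sqrt[OF this] have "(\<lambda>N. norm (v (r N))) \<longlonglongrightarrow> 0" by simp
  with vanishing_solutions[OF v q r] have "q = 0" .
  then have "f = p" by (simp add: q_def)
  then show ?thesis using p by simp
qed

lemma norm_eq_coord:
  "f \<in> M \<Longrightarrow> (norm f)\<^sup>2 = (\<Sum>j<m. (norm (coord f j))\<^sup>2)"
  by (rule norm_eq_if_stable[OF _ remainder_stable])

end

section \<open>The space of coordinate tuples\<close>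

context wandering_expansion
begin

definition coord_space :: "(nat \<Rightarrow> real_hardy) set" where
  "coord_space = (\<lambda>f j. if j < m then coord f j else 0) ` M"

lemma subspace_coord_space: "subspace coord_space"
proof (rule subspaceI)
  have "coord 0 j = 0" if "j < m" for j
    using coord_scale[OF subspace_0[OF subspace_M] that, of 0] by simp
  then show "0 \<in> coord_space"
    unfolding coord_space_def
    by (intro image_eqI[of _ _ 0] subspace_0[OF subspace_M]) (auto simp: fun_eq_iff)
next
  fix x y assume "x \<in> coord_space" "y \<in> coord_space"
  then obtain f g where "f \<in> M" "g \<in> M"
    and "x = (\<lambda>j. if j < m then coord f j else 0)" "y = (\<lambda>j. if j < m then coord g j else 0)"
    by (auto simp: coord_space_def)
  then show "x + y \<in> coord_space"
    unfolding coord_space_def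
    by (intro image_eqI[of _ _ "f + g"] subspace_add[OF subspace_M]) (auto simp: fun_eq_iff coord_add)
next
  fix c :: real and x assume "x \<in> coord_space"
  then obtain f where "f \<in> M" and "x = (\<lambda>j. if j < m then coord f j else 0)"
    by (auto simp: coord_space_def)
  then show "c *\<^sub>R x \<in> coord_space"
    unfolding coord_space_def
    by (intro image_eqI[of _ _ "c *\<^sub>R f"] subspace_scale[OF subspace_M])
      (auto simp: fun_eq_iff coord_scale scaleR_fun_def)
qed

lemma norm_le_sum_coord: "f \<in> M \<Longrightarrow> norm f \<le> (\<Sum>j<m. norm (coord f j))"
  using L2_set_le_sum[of "{..<m}" "\<lambda>j. norm (coord f j)"]
  by (simp add: L2_set_def norm_eq_coord[symmetric])

text \<open>
  By the norm identity the coordinate map is an isometry, so coordinatewise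
  convergence of the tuples makes the functions themselves a Cauchy sequence in \<open>M\<close>.
\<close>

lemma closed_coord_space: "closed coord_space"
proof (rule closed_sequential_limits[THEN iffD2], intro allI impI, elim conjE)
  fix x c assume x: "\<forall>k. x k \<in> coord_space" and lim: "x \<longlonglongrightarrow> c"
  then have "\<forall>k. \<exists>f. f \<in> M \<and> x k = (\<lambda>j. if j < m then coord f j else 0)"
    by (auto simp: coord_space_def)
  from choice[OF this] obtain f where f: "\<And>k. f k \<in> M"
    and xf: "\<And>k. x k = (\<lambda>j. if j < m then coord (f k) j else 0)"
    by blast
  have lim_j: "(\<lambda>k. x k j) \<longlonglongrightarrow> c j" for j
    using continuous_on_tendsto_compose[OF continuous_on_product_coordinates lim, of j] by simp
  have coord_lim: "(\<lambda>k. coord (f k) j) \<longlonglongrightarrow> c j" if "j < m" for j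
    using lim_j[of j] that by (simp add: xf)
  have "Cauchy f"
  proof (rule CauchyI)
    fix e :: real assume e: "0 < e"
    \<comment> \<open>\<open>m + 1\<close> instead of \<open>m\<close>, since \<open>m = 0\<close> is possible\<close>
    define d where "d = e / (real m + 1)"
    have d: "0 < d" using e by (simp add: d_def)
    have "\<forall>j\<in>{..<m}. \<exists>K. \<forall>k\<ge>K. \<forall>l\<ge>K. norm (coord (f k) j - coord (f l) j) < d"
      using CauchyD[OF LIMSEQ_imp_Cauchy[OF coord_lim] d] by blast
    from bchoice[OF this] obtain K where
      K: "\<And>j k l. j < m \<Longrightarrow> k \<ge> K j \<Longrightarrow> l \<ge> K j \<Longrightarrow> norm (coord (f k) j - coord (f l) j) < d"
      by (metis lessThan_iff)
    have "norm (f k - f l) < e" if kl: "k \<ge> (\<Sum>j<m. K j)" "l \<ge> (\<Sum>j<m. K j)" for k l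
    proof -
      have "norm (f k - f l) \<le> (\<Sum>j<m. norm (coord (f k - f l) j))"
        by (intro norm_le_sum_coord subspace_diff[OF subspace_M] f)
      also have "\<dots> \<le> (\<Sum>j<m. d)"
      proof (rule sum_mono)
        fix j assume "j \<in> {..<m}"
        moreover from this have "K j \<le> (\<Sum>j<m. K j)" by (intro member_le_sum) auto
        ultimately show "norm (coord (f k - f l) j) \<le> d"
          using K[of j k l] kl by (simp add: coord_diff f)
      qed
      also have "\<dots> < e"
        using e by (simp add: d_def field_simps)
      finally show ?thesis .
    qed
    then show "\<exists>K. \<forall>k\<ge>K. \<forall>l\<ge>K. norm (f k - f l) < e" by blast
  qed
  then obtain f' where f': "f \<longlonglongrightarrow> f'" using Cauchy_convergent convergent_def by blast
  have f'M: "f' \<in> M" using closed_sequentially[OF closed_M] f f' by blast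
  have "c = (\<lambda>j. if j < m then coord f' j else 0)"
  proof
    fix j
    show "c j = (if j < m then coord f' j else 0)"
    proof (cases "j < m")
      case True
      have "(\<lambda>k. coord (f k) j - coord f' j) \<longlonglongrightarrow> 0"
      proof (rule Lim_null_comparison)
        show "\<forall>\<^sub>F k in sequentially. norm (coord (f k) j - coord f' j) \<le> norm (f k - f')"
          using norm_coord_le[OF subspace_diff[OF subspace_M f f'M] True]
          by (simp add: coord_diff f f'M True)
        show "(\<lambda>k. norm (f k - f')) \<longlonglongrightarrow> 0"
          using f' by (simp add: tendsto_norm_zero_iff LIM_zero)
      qed
      then have "(\<lambda>k. coord (f k) j) \<longlonglongrightarrow> coord f' j" by (rule LIM_zero_cancel)
      with coord_lim[OF True] show ?thesis using True LIMSEQ_unique by auto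
    next
      case False
      then have "(\<lambda>k. x k j) = (\<lambda>k. 0)" by (simp add: xf)
      with lim_j[of j] False show ?thesis by (metis LIMSEQ_unique tendsto_const)
    qed
  qed
  then show "c \<in> coord_space" using f'M by (simp add: coord_space_def)
qed

lemma coord_space_invariant: "c \<in> coord_space \<Longrightarrow> (\<lambda>j. bshift (c j)) \<in> coord_space"
  unfolding coord_space_def
  by (auto intro!: image_eqI[OF _ rem_in] simp: coord_rem linear_0[OF linear_bshift])

lemma series_image: "series ` M = {(\<Sum>j<m. series (c j) * series (w j)) | c. c \<in> coord_space}"
proof -
  have expand: "series f = (\<Sum>j<m. series (if j < m then coord f j else 0) * series (w j))" if "f \<in> M" for f
    using series_expansion[OF that] by simp
  show ?thesis
  proof (intro equalityI subsetI)
    fix x assume "x \<in> series ` M"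
    then obtain f where "f \<in> M" "x = series f" by blast
    then show "x \<in> {(\<Sum>j<m. series (c j) * series (w j)) | c. c \<in> coord_space}"
      using expand[of f] unfolding coord_space_def
      by (intro CollectI exI[of _ "\<lambda>j. if j < m then coord f j else 0"]) auto
  next
    fix x assume "x \<in> {(\<Sum>j<m. series (c j) * series (w j)) | c. c \<in> coord_space}"
    then obtain f where "f \<in> M" "x = (\<Sum>j<m. series (if j < m then coord f j else 0) * series (w j))"
      unfolding coord_space_def by blast
    then show "x \<in> series ` M" using expand by (metis image_eqI)
  qed
qed

text \<open>
  The coordinates are determined by the function, since the tuple in \<open>coord_space\<close> comes from some
  \<open>f'\<close> with the same series.
\<close>

lemma norm_coord_space:
  assumes "f \<in> M" "c \<in> coord_space" "series f = (\<Sum>j<m. series (c j) * series (w j))"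
  shows "(norm f)\<^sup>2 = (\<Sum>j<m. (norm (c j))\<^sup>2)"
proof -
  obtain f' where f': "f' \<in> M" "c = (\<lambda>j. if j < m then coord f' j else 0)"
    using assms(2) by (auto simp: coord_space_def)
  then have "series f = series f'"
    using assms(3) by (simp add: series_expansion)
  then have "f = f'" by (simp add: series_inject)
  then show ?thesis using norm_eq_coord[OF f'(1)] f'(2) by simp
qed

end

section \<open>Orthonormal bases of finite-dimensional subspaces\<close>

lemma inner_onb_sum:
  assumes "orthonormal_basis n e F" "i < n"
  shows "inner (\<Sum>j<n. c j *\<^sub>R e j) (e i) = c i"
proof -
  have "inner (\<Sum>j<n. c j *\<^sub>R e j) (e i) = (\<Sum>j<n. if j = i then c j else 0)"
    unfolding inner_sum_left
    using assms by (intro sum.cong) (auto simp: orthonormal_basis_def)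
  then show ?thesis using assms(2) by simp
qed

lemma onb_expand:
  assumes onb: "orthonormal_basis n e F" and u: "u \<in> F"
  shows "u = (\<Sum>j<n. inner u (e j) *\<^sub>R e j)"
proof -
  have "subspace (range (\<lambda>c. \<Sum>j<n. c j *\<^sub>R e j))"
  proof (rule subspaceI)
    show "0 \<in> range (\<lambda>c. \<Sum>j<n. c j *\<^sub>R e j)"
      by (rule image_eqI[of _ _ "\<lambda>_. 0"]) auto
  next
    fix x y assume "x \<in> range (\<lambda>c. \<Sum>j<n. c j *\<^sub>R e j)" "y \<in> range (\<lambda>c. \<Sum>j<n. c j *\<^sub>R e j)"
    then obtain a b where "x = (\<Sum>j<n. a j *\<^sub>R e j)" "y = (\<Sum>j<n. b j *\<^sub>R e j)" by blast
    then show "x + y \<in> range (\<lambda>c. \<Sum>j<n. c j *\<^sub>R e j)"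
      by (intro image_eqI[of _ _ "\<lambda>j. a j + b j"]) (auto simp: scaleR_add_left sum.distrib)
  next
    fix r :: real and x assume "x \<in> range (\<lambda>c. \<Sum>j<n. c j *\<^sub>R e j)"
    then obtain a where "x = (\<Sum>j<n. a j *\<^sub>R e j)" by blast
    then show "r *\<^sub>R x \<in> range (\<lambda>c. \<Sum>j<n. c j *\<^sub>R e j)"
      by (intro image_eqI[of _ _ "\<lambda>j. r * a j"]) (auto simp: scaleR_sum_right)
  qed
  moreover have "e ` {..<n} \<subseteq> range (\<lambda>c. \<Sum>j<n. c j *\<^sub>R e j)"
  proof
    fix x assume "x \<in> e ` {..<n}"
    then obtain i where "i < n" "x = e i" by auto
    moreover have "(\<Sum>j<n. (if j = i then 1 else 0) *\<^sub>R e j) = (\<Sum>j<n. if j = i then e j else 0)"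
      by (rule sum.cong) auto
    ultimately show "x \<in> range (\<lambda>c. \<Sum>j<n. c j *\<^sub>R e j)"
      by (intro image_eqI[of _ _ "\<lambda>j. if j = i then 1 else 0"]) auto
  qed
  ultimately have "span (e ` {..<n}) \<subseteq> range (\<lambda>c. \<Sum>j<n. c j *\<^sub>R e j)"
    by (intro span_minimal)
  then obtain c where c: "u = (\<Sum>j<n. c j *\<^sub>R e j)"
    using u onb by (auto simp: orthonormal_basis_def)
  then show ?thesis
    using inner_onb_sum[OF onb] by simp
qed

lemma dim_onb:
  assumes "orthonormal_basis n e F"
  shows "dim F = n"
proof -
  have e: "inner (e i) (e j) = (if i = j then 1 else 0)" if "i < n" "j < n" for i j
    using assms that by (simp add: orthonormal_basis_def)
  have inj: "inj_on e {..<n}"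
  proof (rule inj_onI)
    fix i j assume "i \<in> {..<n}" "j \<in> {..<n}" "e i = e j"
    then show "i = j" using e[of i j] e[of i i] by (auto split: if_splits)
  qed
  have "independent (e ` {..<n})"
  proof (rule pairwise_orthogonal_independent)
    show "pairwise orthogonal (e ` {..<n})"
      using e by (auto simp: pairwise_def orthogonal_def)
    show "0 \<notin> e ` {..<n}" using e by (metis imageE inner_zero_left lessThan_iff zero_neq_one)
  qed
  then have "dim (span (e ` {..<n})) = card (e ` {..<n})"
    by (rule dim_span_eq_card_independent)
  then show ?thesis
    using assms card_image[OF inj] by (metis card_lessThan dim_span orthonormal_basis_def)
qed

lemma finite_dim_onb: "orthonormal_basis n e F \<Longrightarrow> finite_dim_subspace F"
  unfolding orthonormal_basis_def finite_dim_subspace_def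
  by (metis finite_imageI finite_lessThan subspace_span)

lemma ex_onb:
  assumes "finite_dim_subspace (F :: 'a::real_inner set)"
  shows "\<exists>e. orthonormal_basis (dim F) e F"
proof -
  obtain B where "finite B" "F = span B"
    using assms by (auto simp: finite_dim_subspace_def)
  from basis_orthogonal[OF this(1)] obtain C0 where
    C0: "finite C0" "span C0 = F" "pairwise orthogonal C0"
    using \<open>F = span B\<close> by auto
  define C where "C = C0 - {0}"
  have C: "finite C" "span C = F" "pairwise orthogonal C" "0 \<notin> C"
    using C0 by (auto simp: C_def span_delete_0 pairwise_def)
  have "independent C" by (rule pairwise_orthogonal_independent) (use C in auto)
  then have card: "card C = dim F"
    using C(2) dim_span_eq_card_independent by metis
  obtain h where h: "bij_betw h {0..<card C} C"
    using ex_bij_betw_nat_finite[OF C(1)] by blast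
  define e where "e i = inverse (norm (h i)) *\<^sub>R h i" for i
  have hC: "h i \<in> C" if "i < dim F" for i
    using h that card by (auto simp: bij_betw_def)
  have "inner (e i) (e j) = (if i = j then 1 else 0)" if "i < dim F" "j < dim F" for i j
  proof (cases "i = j")
    case True
    have "h i \<noteq> 0" using hC[OF that(1)] C(4) by auto
    then show ?thesis
      using True by (simp add: e_def power2_norm_eq_inner[symmetric] power2_eq_square)
  next
    case False
    have "h i \<noteq> h j"
      by (rule inj_on_contraD[OF bij_betw_imp_inj_on[OF h] False]) (use that card in auto)
    then have "inner (h i) (h j) = 0"
      using hC[OF that(1)] hC[OF that(2)] C(3) by (simp add: pairwise_def orthogonal_def)
    then show ?thesis
      using False by (simp add: e_def)
  qed
  moreover have "span (e ` {..<dim F}) = F"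
  proof -
    have "h ` {..<dim F} = C"
      using bij_betw_imp_surj_on[OF h] by (simp add: card atLeast0LessThan)
    then have "e ` {..<dim F} = (\<lambda>x. inverse (norm x) *\<^sub>R x) ` C"
      unfolding e_def by (simp add: image_image flip: \<open>h ` {..<dim F} = C\<close>)
    also have "span \<dots> = span C"
      by (rule span_image_scale[OF C(1)]) (use C(4) in auto)
    finally show ?thesis using C(2) by simp
  qed
  ultimately show ?thesis unfolding orthonormal_basis_def by blast
qed

lemma sum_space_project:
  assumes M: "subspace M" and orth: "orthogonal_sets M F" and onb: "orthonormal_basis n e F"
    and x: "x \<in> sum_space M F"
  shows "x - (\<Sum>i<n. inner x (e i) *\<^sub>R e i) \<in> M"
    and "(norm x)\<^sup>2 = (\<Sum>i<n. (inner x (e i))\<^sup>2) + (norm (x - (\<Sum>i<n. inner x (e i) *\<^sub>R e i)))\<^sup>2"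
proof -
  obtain p u where x: "x = p + u" "p \<in> M" "u \<in> F"
    using x by (auto simp: sum_space_def)
  have eF: "e i \<in> F" if "i < n" for i
    using onb that unfolding orthonormal_basis_def by (metis imageI lessThan_iff span_base)
  have xu: "inner x (e i) = inner u (e i)" if "i < n" for i
    using orth x(2) eF[OF that] by (simp add: x(1) inner_add_left orthogonal_sets_def orthogonal_def)
  have sum_u: "(\<Sum>i<n. inner x (e i) *\<^sub>R e i) = u"
    using onb_expand[OF onb x(3)] xu by simp
  show "x - (\<Sum>i<n. inner x (e i) *\<^sub>R e i) \<in> M"
    unfolding sum_u by (simp add: x)
  have "inner u u = inner u (\<Sum>i<n. inner u (e i) *\<^sub>R e i)"
    using onb_expand[OF onb x(3)] by simp
  also have "\<dots> = (\<Sum>i<n. (inner x (e i))\<^sup>2)"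
    by (simp add: inner_sum_right xu power2_eq_square)
  finally have "inner u u = (\<Sum>i<n. (inner x (e i))\<^sup>2)" .
  moreover have "inner p u = 0"
    using orth x by (simp add: orthogonal_sets_def orthogonal_def)
  ultimately show "(norm x)\<^sup>2 = (\<Sum>i<n. (inner x (e i))\<^sup>2) + (norm (x - (\<Sum>i<n. inner x (e i) *\<^sub>R e i)))\<^sup>2"
    unfolding sum_u by (simp add: x(1) power2_norm_eq_inner inner_add_left inner_add_right inner_commute)
qed

lemma subspace_sum_space:
  assumes "subspace M" "subspace F"
  shows "subspace (sum_space M F)"
proof -
  have "sum_space M F = {x + y | x y. x \<in> M \<and> y \<in> F}" by (auto simp: sum_space_def)
  then show ?thesis using subspace_sums[OF assms] by simp
qed

section \<open>From invariance to the representation\<close>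

text \<open>
  The step common to both cases. For \<open>f\<close> vanishing at 0 the shift is isometric, and the component
  of \<open>bshift f\<close> in \<open>F\<close> has the coefficients \<open>\<langle>bshift f,
  e\<^sub>i\<rangle> = \<langle>f, z e\<^sub>i\<rangle>\<close>.
\<close>

lemma remainder_of_vanishing:
  assumes M: "subspace M" and inv: "almost_invariant_wrt M F" and onb: "orthonormal_basis n e F"
    and f: "f \<in> M" "coef f 0 = 0"
  defines "r \<equiv> f - (\<Sum>i<n. inner f (fshift (e i)) *\<^sub>R fshift (e i))"
  shows "coef r 0 = 0" and "bshift r \<in> M"
    and "(norm f)\<^sup>2 = (\<Sum>i<n. (inner f (fshift (e i)))\<^sup>2) + (norm (bshift r))\<^sup>2"
proof -
  have orth: "orthogonal_sets M F" and sub: "bshift f \<in> sum_space M F"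
    using inv f(1) by (auto simp: almost_invariant_wrt_def)
  have r: "bshift r = bshift f - (\<Sum>i<n. inner (bshift f) (e i) *\<^sub>R e i)"
    by (simp add: r_def linear_diff[OF linear_bshift] linear_sum[OF linear_bshift]
        linear_scale[OF linear_bshift] inner_fshift_right)
  show "coef r 0 = 0" by (simp add: r_def f(2))
  show "bshift r \<in> M" unfolding r by (rule sum_space_project(1)[OF M orth onb sub])
  show "(norm f)\<^sup>2 = (\<Sum>i<n. (inner f (fshift (e i)))\<^sup>2) + (norm (bshift r))\<^sup>2"
    using sum_space_project(2)[OF M orth onb sub] norm_bshift_sq[of f] f(2)
    by (simp add: r inner_fshift_right)
qed

lemma vanishing_form_if_almost_invariant:
  assumes M: "subspace M" "closed M" and inv: "almost_invariant_wrt M F" and onb: "orthonormal_basis n e F"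
    and van: "\<And>f. f \<in> M \<Longrightarrow> coef f 0 = 0"
  shows "vanishing_form n M e"
proof -
  interpret wandering_expansion M n "\<lambda>i. fshift (e i)" "\<lambda>i. fshift (e i)"
    using remainder_of_vanishing[OF M(1) inv onb _ van] M by unfold_locales blast+
  have rep: "(\<Sum>j<n. series (c j) * series (fshift (e j))) = rep_vanishing n e c" for c
    by (simp add: rep_vanishing_def fshift.rep_eq sum_distrib_left mult_ac)
  show ?thesis
    unfolding vanishing_form_def
  proof (intro conjI exI[of _ coord_space])
    show "\<forall>f\<in>M. fps_nth (series f) 0 = 0" using van by (simp add: fps_nth_series)
    show "coord_space \<subseteq> vec_hardy n" by (auto simp: coord_space_def vec_hardy_def)
    show "\<forall>H\<in>coord_space. vec_bshift H \<in> coord_space"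
      using coord_space_invariant by (simp add: vec_bshift_def)
    show "series ` M = {rep_vanishing n e H |H. H \<in> coord_space}"
      using series_image by (simp add: rep)
    show "\<forall>f\<in>M. \<forall>H\<in>coord_space. series f = rep_vanishing n e H \<longrightarrow> (norm f)\<^sup>2 = (\<Sum>i<n. (norm (H i))\<^sup>2)"
      using norm_coord_space by (simp add: rep)
  qed (rule subspace_coord_space closed_coord_space)+
qed

text \<open>
  Take a function of \<open>M\<close> not vanishing at 0, remove its projection onto those
  that do, and normalize size and sign.
\<close>

lemma extremal_function_exists:
  assumes M: "subspace M" "closed M" and f0: "f0 \<in> M" "coef f0 0 \<noteq> 0"
  shows "\<exists>g\<in>M. norm g = 1 \<and> coef g 0 > 0 \<and> (\<forall>f\<in>M. coef f 0 = 0 \<longrightarrow> inner g f = 0)"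
proof -
  have Z: "{f. coef f 0 = 0} = {f. inner one_hardy f = 0}"
    by (simp add: inner_one inner_commute[of one_hardy])
  have S: "subspace (M \<inter> {f. coef f 0 = 0})" "closed (M \<inter> {f. coef f 0 = 0})"
    unfolding Z using subspace_inter[OF M(1) subspace_hyperplane] closed_Int[OF M(2) closed_hyperplane] .
  obtain p where p: "p \<in> M" "coef p 0 = 0"
    and orth: "\<And>s. s \<in> M \<Longrightarrow> coef s 0 = 0 \<Longrightarrow> inner (f0 - p) s = 0"
    using orthogonal_projection_exists[OF S, of f0] by auto
  define q where "q = f0 - p"
  have q0: "coef q 0 \<noteq> 0" using f0 p by (simp add: q_def)
  then have "q \<noteq> 0" by auto
  define g where "g = (sgn (coef q 0) / norm q) *\<^sub>R q"
  have "g \<in> M" unfolding g_def q_def by (intro subspace_scale subspace_diff M f0 p)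
  moreover have "norm g = 1" using \<open>q \<noteq> 0\<close> q0 by (simp add: g_def abs_sgn_eq)
  moreover have "coef g 0 > 0"
  proof -
    have "coef g 0 = \<bar>coef q 0\<bar> / norm q" by (simp add: g_def abs_sgn mult.commute)
    then show ?thesis using \<open>q \<noteq> 0\<close> q0 by simp
  qed
  moreover have "\<forall>f\<in>M. coef f 0 = 0 \<longrightarrow> inner g f = 0"
    using orth by (simp add: g_def q_def)
  ultimately show ?thesis by blast
qed

text \<open>
  The functions of \<open>M\<close> vanishing at 0 have codimension one and are orthogonal to \<open>g\<close>,
  so \<open>f - \<langle>f, g\<rangle> g\<close> vanishes at 0 and \<open>remainder_of_vanishing\<close> applies
  to it. Written in terms of \<open>f\<close>, the scalars \<open>\<langle>f - \<langle>f, g\<rangle> g, z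
  e\<^sub>i\<rangle>\<close> are inner products with \<open>z e\<^sub>i - \<langle>g, z e\<^sub>i\<rangle>
  g\<close>.
\<close>

lemma nonvanishing_form_if_almost_invariant:
  assumes M: "subspace M" "closed M" and inv: "almost_invariant_wrt M F" and onb: "orthonormal_basis n e F"
    and f0: "f0 \<in> M" "coef f0 0 \<noteq> 0"
  shows "nonvanishing_form n M F e"
proof -
  obtain g where g: "g \<in> M" "norm g = 1" "coef g 0 > 0"
    and g_orth: "\<And>f. f \<in> M \<Longrightarrow> coef f 0 = 0 \<Longrightarrow> inner g f = 0"
    using extremal_function_exists[OF M f0] by blast
  define w where "w = case_nat g (\<lambda>i. fshift (e i))"
  define \<delta> where "\<delta> = case_nat g (\<lambda>i. fshift (e i) - inner g (fshift (e i)) *\<^sub>R g)"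
  have split: "f - (\<Sum>j<Suc n. inner f (\<delta> j) *\<^sub>R w j)
      = (f - inner f g *\<^sub>R g) - (\<Sum>i<n. inner (f - inner f g *\<^sub>R g) (fshift (e i)) *\<^sub>R fshift (e i))" for f
    unfolding sum.lessThan_Suc_shift
    by (simp add: w_def \<delta>_def inner_diff_left inner_diff_right inner_commute mult.commute)
  have sums: "(\<Sum>j<Suc n. (inner f (\<delta> j))\<^sup>2)
      = (inner f g)\<^sup>2 + (\<Sum>i<n. (inner (f - inner f g *\<^sub>R g) (fshift (e i)))\<^sup>2)" for f
    unfolding sum.lessThan_Suc_shift
    by (simp add: \<delta>_def inner_diff_left inner_diff_right inner_commute mult.commute)
  have van: "f - inner f g *\<^sub>R g \<in> M" "coef (f - inner f g *\<^sub>R g) 0 = 0"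
    "(norm f)\<^sup>2 = (inner f g)\<^sup>2 + (norm (f - inner f g *\<^sub>R g))\<^sup>2" if f: "f \<in> M" for f
  proof -
    have gg: "inner g g = 1" using g(2) by (simp add: power2_norm_eq_inner[symmetric])
    \<comment> \<open>the multiple of \<open>g\<close> that cancels the value of \<open>f\<close> at 0; orthogonality identifies it\<close>
    define c where "c = coef f 0 / coef g 0"
    have "f - c *\<^sub>R g \<in> M" by (intro subspace_diff subspace_scale M f g)
    moreover have "coef (f - c *\<^sub>R g) 0 = 0" using g(3) by (simp add: c_def)
    ultimately have "inner g (f - c *\<^sub>R g) = 0" by (rule g_orth)
    then have "c = inner f g" by (simp add: inner_diff_right gg inner_commute)
    with \<open>f - c *\<^sub>R g \<in> M\<close> \<open>coef (f - c *\<^sub>R g) 0 = 0\<close>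
    show "f - inner f g *\<^sub>R g \<in> M" "coef (f - inner f g *\<^sub>R g) 0 = 0" by auto
    show "(norm f)\<^sup>2 = (inner f g)\<^sup>2 + (norm (f - inner f g *\<^sub>R g))\<^sup>2"
      unfolding power2_norm_eq_inner
      by (simp add: inner_diff_left inner_diff_right inner_commute gg power2_eq_square)
  qed
  interpret wandering_expansion M "Suc n" w \<delta>
  proof
    fix f assume f: "f \<in> M"
    note rest = remainder_of_vanishing[OF M(1) inv onb van(1,2)[OF f]]
    show "coef (f - (\<Sum>j<Suc n. inner f (\<delta> j) *\<^sub>R w j)) 0 = 0"
      and "bshift (f - (\<Sum>j<Suc n. inner f (\<delta> j) *\<^sub>R w j)) \<in> M"
      unfolding split by (rule rest)+
    show "(norm f)\<^sup>2 = (\<Sum>j<Suc n. (inner f (\<delta> j))\<^sup>2)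
        + (norm (bshift (f - (\<Sum>j<Suc n. inner f (\<delta> j) *\<^sub>R w j))))\<^sup>2"
      unfolding split sums using van(3)[OF f] rest(3) by simp
  qed (use M in auto)
  \<comment> \<open>puts \<open>h\<close> in front of \<open>H\<close>, matching the generators with \<open>w\<close>\<close>
  define join :: "real_hardy \<times> (nat \<Rightarrow> real_hardy) \<Rightarrow> nat \<Rightarrow> real_hardy"
    where "join = (\<lambda>(h, H). case_nat h H)"
  define N where "N = join -` coord_space"
  have rep: "(\<Sum>j<Suc n. series (join (h, H) j) * series (w j)) = rep_nonvanishing n g e h H" for h H
    unfolding sum.lessThan_Suc_shift
    by (simp add: join_def w_def rep_nonvanishing_def fshift.rep_eq sum_distrib_left mult_ac)
  have "linear join"
    by (rule linearI) (auto simp: join_def fun_eq_iff scaleR_fun_def split: nat.split)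
  then have "subspace N"
    unfolding N_def by (rule linear_subspace_vimage[OF _ subspace_coord_space])
  moreover have "closed N"
    unfolding N_def
  proof (rule closed_vimage[OF closed_coord_space], rule continuous_on_coordinatewise_then_product)
    fix j
    have "continuous_on UNIV (\<lambda>p :: real_hardy \<times> (nat \<Rightarrow> real_hardy). snd p i)" for i
      by (rule continuous_on_compose2[OF continuous_on_product_coordinates continuous_on_snd]) auto
    then show "continuous_on UNIV (\<lambda>p. join p j)"
      by (cases j) (auto simp: join_def case_prod_unfold intro: continuous_intros)
  qed
  moreover have "N \<subseteq> UNIV \<times> vec_hardy n"
  proof clarify
    fix h H assume "(h, H) \<in> N"
    then have "join (h, H) (Suc i) = 0" if "i \<ge> n" for i
      using that by (auto simp: N_def coord_space_def)
    then show "h \<in> UNIV \<and> H \<in> vec_hardy n" by (simp add: join_def vec_hardy_def)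
  qed
  moreover have "\<forall>(h, H)\<in>N. (bshift h, vec_bshift H) \<in> N"
  proof clarify
    fix h H assume "(h, H) \<in> N"
    moreover have "join (bshift h, vec_bshift H) = (\<lambda>j. bshift (join (h, H) j))"
      by (auto simp: join_def vec_bshift_def split: nat.split)
    ultimately show "(bshift h, vec_bshift H) \<in> N"
      using coord_space_invariant by (simp add: N_def)
  qed
  moreover have "series ` M = {rep_nonvanishing n g e h H | h H. (h, H) \<in> N}"
  proof -
    have "join (c 0, \<lambda>i. c (Suc i)) = c" for c
      by (auto simp: join_def split: nat.split)
    then have "{(\<Sum>j<Suc n. series (c j) * series (w j)) | c. c \<in> coord_space}
        = {(\<Sum>j<Suc n. series (join (h, H) j) * series (w j)) | h H. (h, H) \<in> N}"
      unfolding N_def vimage_eq by (intro Collect_cong) metis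
    then show ?thesis
      unfolding series_image by (simp only: rep)
  qed
  moreover have "\<forall>f\<in>M. \<forall>(h, H)\<in>N. series f = rep_nonvanishing n g e h H \<longrightarrow>
      (norm f)\<^sup>2 = (norm h)\<^sup>2 + (\<Sum>i<n. (norm (H i))\<^sup>2)"
  proof clarify
    fix f h H assume "f \<in> M" "(h, H) \<in> N" "series f = rep_nonvanishing n g e h H"
    then have "(norm f)\<^sup>2 = (\<Sum>j<Suc n. (norm (join (h, H) j))\<^sup>2)"
      by (intro norm_coord_space) (simp_all only: rep N_def vimage_eq)
    then show "(norm f)\<^sup>2 = (norm h)\<^sup>2 + (\<Sum>i<n. (norm (H i))\<^sup>2)"
      unfolding sum.lessThan_Suc_shift by (simp add: join_def)
  qed
  moreover have "orthogonal_sets {g} (M \<inter> z_hardy)"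
    using g_orth by (auto simp: orthogonal_sets_def orthogonal_def z_hardy_iff)
  moreover have "bshift g \<in> sum_space M F"
    using inv g(1) by (auto simp: almost_invariant_wrt_def)
  moreover have "\<exists>f\<in>M. fps_nth (series f) 0 \<noteq> 0"
    using f0 by (auto simp: fps_nth_series)
  moreover have "Re (fps_nth (series g) 0) > 0" using g(3) by (simp add: coef_def)
  ultimately show ?thesis
    unfolding nonvanishing_form_def using g(1,2) by blast
qed

section \<open>From the representation to invariance\<close>

lemma series_decompose: "series f = fps_const (of_real (coef f 0)) + fps_X * series (bshift f)"
proof (rule fps_ext)
  fix k show "fps_nth (series f) k = fps_nth (fps_const (of_real (coef f 0)) + fps_X * series (bshift f)) k"
    by (cases k) (simp_all add: fps_nth_series)
qed

lemma rep_vanishing_step: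
  "rep_vanishing n e H
    = fps_X * (rep_vanishing n e (vec_bshift H) + series (\<Sum>i<n. coef (H i) 0 *\<^sub>R e i))"
proof -
  have "series (H i) * series (e i)
      = fps_X * (series (vec_bshift H i) * series (e i)) + fps_const (of_real (coef (H i) 0)) * series (e i)" for i
    by (subst series_decompose[of "H i"]) (simp add: vec_bshift_def algebra_simps)
  then show ?thesis
    by (simp add: rep_vanishing_def series_sum scaleR_real_hardy.rep_eq sum.distrib sum_distrib_left)
qed

lemma rep_nonvanishing_step:
  "rep_nonvanishing n g e h H = series (coef h 0 *\<^sub>R g)
    + fps_X * (rep_nonvanishing n g e (bshift h) (vec_bshift H) + series (\<Sum>i<n. coef (H i) 0 *\<^sub>R e i))"
proof -
  have "series g * series h = series (coef h 0 *\<^sub>R g) + fps_X * (series g * series (bshift h))"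
    by (subst series_decompose[of h]) (simp add: scaleR_real_hardy.rep_eq algebra_simps)
  then show ?thesis
    using rep_vanishing_step[of n e H]
    by (simp add: rep_nonvanishing_def rep_vanishing_def algebra_simps)
qed

text \<open>
  Splitting off the constant terms of the coordinates leaves the representation of the shifted
  tuple, which belongs to \<open>N\<close> and so represents some \<open>f'\<close> in \<open>M\<close>.
\<close>

lemma almost_invariant_if_form:
  assumes M: "subspace M" and orth: "orthogonal_sets M F" and onb: "orthonormal_basis n e F"
    and form: "nonvanishing_form n M F e \<or> vanishing_form n M e"
  shows "almost_invariant_wrt M F"
proof -
  have F: "subspace F" using finite_dim_onb[OF onb] by (simp add: finite_dim_subspace_def)
  have sumF: "(\<Sum>i<n. c i *\<^sub>R e i) \<in> F" for c
    using onb unfolding orthonormal_basis_def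
    by (auto intro!: subspace_sum[OF F] subspace_scale[OF F] span_base)
  have MF: "p + u \<in> sum_space M F" if "p \<in> M" "u \<in> F" for p u
    using that by (auto simp: sum_space_def)
  have "bshift f \<in> sum_space M F" if f: "f \<in> M" for f
    using form
  proof
    assume "vanishing_form n M e"
    then obtain N where inv: "\<forall>H\<in>N. vec_bshift H \<in> N"
      and img: "series ` M = {rep_vanishing n e H | H. H \<in> N}"
      unfolding vanishing_form_def by blast
    obtain H where H: "H \<in> N" "series f = rep_vanishing n e H"
      using img f by blast
    have "rep_vanishing n e (vec_bshift H) \<in> series ` M"
      unfolding img using inv H(1) by blast
    then obtain f' where f': "f' \<in> M" "series f' = rep_vanishing n e (vec_bshift H)"
      by (metis imageE)
    have "series f = series (fshift (f' + (\<Sum>i<n. coef (H i) 0 *\<^sub>R e i)))"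
      unfolding H(2) rep_vanishing_step[of n e H] f'(2)[symmetric]
      by (simp only: fshift.rep_eq plus_real_hardy.rep_eq)
    then have "f = fshift (f' + (\<Sum>i<n. coef (H i) 0 *\<^sub>R e i))" by (simp only: series_inject)
    then have "bshift f = f' + (\<Sum>i<n. coef (H i) 0 *\<^sub>R e i)" by simp
    then show ?thesis using MF[OF f'(1) sumF] by simp
  next
    assume "nonvanishing_form n M F e"
    then obtain g N where inv: "\<forall>(h, H)\<in>N. (bshift h, vec_bshift H) \<in> N"
      and img: "series ` M = {rep_nonvanishing n g e h H | h H. (h, H) \<in> N}"
      and g: "bshift g \<in> sum_space M F"
      unfolding nonvanishing_form_def by blast
    obtain h H where H: "(h, H) \<in> N" "series f = rep_nonvanishing n g e h H"
      using img f by blast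
    have "(bshift h, vec_bshift H) \<in> N" using inv H(1) by blast
    then have "rep_nonvanishing n g e (bshift h) (vec_bshift H) \<in> series ` M"
      unfolding img by blast
    then obtain f' where f': "f' \<in> M" "series f' = rep_nonvanishing n g e (bshift h) (vec_bshift H)"
      by (metis imageE)
    have "series f = series (coef h 0 *\<^sub>R g + fshift (f' + (\<Sum>i<n. coef (H i) 0 *\<^sub>R e i)))"
      unfolding H(2) rep_nonvanishing_step[of n g e h H] f'(2)[symmetric]
      by (simp only: fshift.rep_eq plus_real_hardy.rep_eq)
    then have "f = coef h 0 *\<^sub>R g + fshift (f' + (\<Sum>i<n. coef (H i) 0 *\<^sub>R e i))"
      by (simp only: series_inject)
    then have "bshift f = coef h 0 *\<^sub>R bshift g + (f' + (\<Sum>i<n. coef (H i) 0 *\<^sub>R e i))"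
      by (simp add: linear_add[OF linear_bshift] linear_scale[OF linear_bshift])
    then show ?thesis
      using subspace_add[OF subspace_sum_space[OF M F] subspace_scale[OF subspace_sum_space[OF M F] g]
          MF[OF f'(1) sumF]] by simp
  qed
  then show ?thesis
    using orth finite_dim_onb[OF onb] by (auto simp: almost_invariant_wrt_def)
qed

section \<open>Defect spaces and the two forms\<close>

lemma defect_space_iff_form:
  assumes M: "subspace M" "closed M" and adm: "admissible n M F e"
  shows "defect_space M F \<longleftrightarrow> nonvanishing_form n M F e \<or> vanishing_form n M e"
proof
  have onb: "orthonormal_basis n e F" and orth: "orthogonal_sets M F"
    and min: "\<And>F'. almost_invariant_wrt M F' \<Longrightarrow> n \<le> dim F'"
    using adm by (auto simp: admissible_def)
  {
    assume "defect_space M F"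
    then have inv: "almost_invariant_wrt M F" by (simp add: defect_space_def)
    show "nonvanishing_form n M F e \<or> vanishing_form n M e"
      using vanishing_form_if_almost_invariant[OF M inv onb]
        nonvanishing_form_if_almost_invariant[OF M inv onb] by blast
  next
    assume "nonvanishing_form n M F e \<or> vanishing_form n M e"
    from almost_invariant_if_form[OF M(1) orth onb this] show "defect_space M F"
      using min by (simp add: defect_space_def dim_onb[OF onb])
  }
qed

lemma defect_eq_iff:
  "almost_invariant M \<and> defect M = n \<longleftrightarrow> (\<exists>F. defect_space M F \<and> dim F = n)"
proof
  assume *: "almost_invariant M \<and> defect M = n"
  then have "\<exists>d F. almost_invariant_wrt M F \<and> dim F = d"
    unfolding almost_invariant_def by blast
  from LeastI_ex[OF this] obtain F where F: "almost_invariant_wrt M F" "dim F = n"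
    using * unfolding defect_def by blast
  moreover have "n \<le> dim F'" if "almost_invariant_wrt M F'" for F'
  proof -
    have "(LEAST d. \<exists>F. almost_invariant_wrt M F \<and> dim F = d) \<le> dim F'"
      by (rule Least_le) (use that in blast)
    then show ?thesis using * by (simp only: defect_def)
  qed
  ultimately show "\<exists>F. defect_space M F \<and> dim F = n" by (auto simp: defect_space_def)
next
  assume "\<exists>F. defect_space M F \<and> dim F = n"
  then obtain F where F: "almost_invariant_wrt M F" "dim F = n"
    and min: "\<And>F'. almost_invariant_wrt M F' \<Longrightarrow> n \<le> dim F'" by (auto simp: defect_space_def)
  have "defect M = n"
    unfolding defect_def by (rule Least_equality) (use F min in auto)
  then show "almost_invariant M \<and> defect M = n" using F by (auto simp: almost_invariant_def)
qed

theorem corollary4p6: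
  fixes M :: "real_hardy set" and n :: nat
  assumes "subspace M" and "closed M" and "M \<noteq> {0}"
  shows "(almost_invariant M \<and> defect M = n \<longleftrightarrow>
            (\<exists>F e. admissible n M F e \<and> (nonvanishing_form n M F e \<or> vanishing_form n M e))) \<and>
         (\<forall>F e. admissible n M F e \<longrightarrow>
            (defect_space M F \<longleftrightarrow> nonvanishing_form n M F e \<or> vanishing_form n M e))"
proof (intro conjI allI impI)
  note main = defect_space_iff_form[OF assms(1,2)]
  have "(\<exists>F. defect_space M F \<and> dim F = n) \<longleftrightarrow> (\<exists>F e. admissible n M F e \<and> defect_space M F)"
  proof
    assume "\<exists>F. defect_space M F \<and> dim F = n"
    then obtain F where F: "defect_space M F" "dim F = n" by blast
    then obtain e where "orthonormal_basis n e F"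
      using ex_onb[of F] by (auto simp: defect_space_def almost_invariant_wrt_def)
    with F have "admissible n M F e"
      by (auto simp: admissible_def defect_space_def almost_invariant_wrt_def)
    with F show "\<exists>F e. admissible n M F e \<and> defect_space M F" by blast
  next
    assume "\<exists>F e. admissible n M F e \<and> defect_space M F"
    then show "\<exists>F. defect_space M F \<and> dim F = n"
      using dim_onb by (auto simp: admissible_def)
  qed
  then show "almost_invariant M \<and> defect M = n \<longleftrightarrow>
      (\<exists>F e. admissible n M F e \<and> (nonvanishing_form n M F e \<or> vanishing_form n M e))"
    unfolding defect_eq_iff using main by blast
  fix F e assume "admissible n M F e"
  then show "defect_space M F \<longleftrightarrow> nonvanishing_form n M F e \<or> vanishing_form n M e" by (rule main)
qed

end
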